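(* Every cactus configuration $M$ is realizable over $\mathbb{C}$ (that is, $\Gamma_M\neq\emptyset$), and its matroid variety $V_M$ is irreducible.
   Context: For a matroid $M$ on $[d]$ of rank at most three: - A realization is a family $(\gamma_1,\dots,\gamma_d)\subset\mathbb{C}^3$ such that $S\subseteq[d]$ is dependent in $M$ if and only if $\{\gamma_i:i\in S\}$ is linearly dependent. - $\Gamma_M\subseteq\mathbb{C}^{3d}$ is the set of realizations, and $V_M$ is its Zariski closure. For a simple rank-three matroid: - A line is a maximal subset with at least three elements all of whose $3$-subsets are dependent. - $\mathcal{L}_p$ is the set of lines containing $p$. Cactus configurations: - A line matroid is a uniform matroid $U_{2,n}$. - A simple matroid with $n$ lines is a cycle if there are points $p_1,\dots,p_n$ and an ordering $l_1,\dots,l_n$ of its lines with $\mathcal{L}_{p_i}=\{l_i,l_{i+1}\}$ (indices mod $n$), and every other point lies on exactly one line. - The free gluing $M\amalg_{p,q}N$ identifies the point $p$ of $M$ with the point $q$ of $N$ into a new point $P$. Its lines are those of $M$ and of $N$ (with $p,q$ replaced by $P$), and no other dependencies are introduced. - A connected cactus configuration is a simple rank-three matroid obtained from a line matroid or cycle by successively freely gluing with line matroids or cycles. - A cactus configuration is a simple rank-three matroid each of whose connected components (with respect to lying on a common line) is a connected cactus configuration. *)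

theory Defs
  imports "HOL-Analysis.Analysis"
begin

section \<open>Matroids\<close>

record 'a set_system =
  ground :: "'a set"
  indeps :: "'a set set"

definition matroid :: "'a set_system \<Rightarrow> bool" where
  "matroid M \<longleftrightarrow>
     finite (ground M) \<and> indeps M \<subseteq> Pow (ground M) \<and> {} \<in> indeps M \<and>
     (\<forall>S\<in>indeps M. \<forall>T. T \<subseteq> S \<longrightarrow> T \<in> indeps M) \<and>
     (\<forall>S\<in>indeps M. \<forall>T\<in>indeps M. card S < card T \<longrightarrow> (\<exists>x\<in>T - S. insert x S \<in> indeps M))"

definition dep :: "'a set_system \<Rightarrow> 'a set \<Rightarrow> bool" where
  "dep M S \<longleftrightarrow> S \<subseteq> ground M \<and> S \<notin> indeps M"

definition matroid_rank :: "'a set_system \<Rightarrow> nat" where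
  "matroid_rank M = Max (card ` indeps M)"

text \<open>No loops and no parallel elements.\<close>

definition simple_matroid :: "'a set_system \<Rightarrow> bool" where
  "simple_matroid M \<longleftrightarrow> matroid M \<and> (\<forall>S. S \<subseteq> ground M \<and> card S \<le> 2 \<longrightarrow> \<not> dep M S)"

definition restriction :: "'a set_system \<Rightarrow> 'a set \<Rightarrow> 'a set_system" where
  "restriction M C = \<lparr>ground = C, indeps = {S \<in> indeps M. S \<subseteq> C}\<rparr>"

section \<open>Lines\<close>

definition collinear_set :: "'a set_system \<Rightarrow> 'a set \<Rightarrow> bool" where
  "collinear_set M l \<longleftrightarrow>
     l \<subseteq> ground M \<and> 3 \<le> card l \<and> (\<forall>S. S \<subseteq> l \<and> card S = 3 \<longrightarrow> dep M S)"

definition matroid_lines :: "'a set_system \<Rightarrow> 'a set set" where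
  "matroid_lines M =
     {l. collinear_set M l \<and> (\<forall>l'. collinear_set M l' \<and> l \<subseteq> l' \<longrightarrow> l' = l)}"

definition lines_through :: "'a set_system \<Rightarrow> 'a \<Rightarrow> 'a set set" where
  "lines_through M p = {l \<in> matroid_lines M. p \<in> l}"

section \<open>Cactus configurations\<close>

text \<open>A uniform matroid \<open>U\<^sub>2\<^sub>,\<^sub>n\<close> with \<open>n \<ge> 3\<close>, so that its ground set is a line.\<close>

definition line_matroid :: "'a set_system \<Rightarrow> bool" where
  "line_matroid M \<longleftrightarrow>
     finite (ground M) \<and> 3 \<le> card (ground M) \<and>
     indeps M = {S. S \<subseteq> ground M \<and> card S \<le> 2}"

text \<open>
  Indices run over \<open>0, \<dots>, n - 1\<close>.  The bound \<open>n \<ge> 3\<close> loses nothing: two lines of a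
  simple matroid share at most one point, so \<open>n = 2\<close> cannot occur with two distinct points
  \<open>p 0\<close>, \<open>p 1\<close>, and \<open>n = 1\<close> would give a line matroid.  For \<open>n \<ge> 3\<close> the points \<open>p i\<close> are
  automatically distinct.
\<close>

definition cycle_matroid :: "'a set_system \<Rightarrow> bool" where
  "cycle_matroid M \<longleftrightarrow>
     simple_matroid M \<and> matroid_rank M = 3 \<and>
     (\<exists>n\<ge>3. \<exists>(p :: nat \<Rightarrow> 'a) l.
        bij_betw l {..<n} (matroid_lines M) \<and>
        (\<forall>i<n. p i \<in> ground M \<and> lines_through M (p i) = {l i, l (Suc i mod n)}) \<and>
        (\<forall>q\<in>ground M - p ` {..<n}. card (lines_through M q) = 1))"

text \<open>
  \<open>free_gluing M p N q K\<close>: \<open>K\<close> is a copy of \<open>M \<amalg>\<^sub>p\<^sub>,\<^sub>q N\<close>.  The relabellings \<open>f\<close> and \<open>g\<close> embed the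
  ground sets of \<open>M\<close> and \<open>N\<close> into that of \<open>K\<close>, overlapping only in the new point \<open>P = f p = g q\<close>.
  Up to three elements, the only dependencies of \<open>K\<close> are the triples contained in a line of \<open>M\<close>
  or of \<open>N\<close>; larger sets are dependent because \<open>K\<close> has rank at most three.
\<close>

definition free_gluing ::
  "'a set_system \<Rightarrow> 'a \<Rightarrow> 'a set_system \<Rightarrow> 'a \<Rightarrow> 'a set_system \<Rightarrow> bool" where
  "free_gluing M p N q K \<longleftrightarrow>
     p \<in> ground M \<and> q \<in> ground N \<and>
     (\<exists>f g. inj_on f (ground M) \<and> inj_on g (ground N) \<and>
        f p = g q \<and> f ` ground M \<inter> g ` ground N = {f p} \<and>
        ground K = f ` ground M \<union> g ` ground N \<and>
        indeps K = {S. S \<subseteq> ground K \<and> card S \<le> 3 \<and>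
          \<not> (card S = 3 \<and>
             ((\<exists>l\<in>matroid_lines M. S \<subseteq> f ` l) \<or> (\<exists>l\<in>matroid_lines N. S \<subseteq> g ` l)))})"

inductive connected_cactus :: "'a set_system \<Rightarrow> bool" where
  line: "line_matroid M \<Longrightarrow> connected_cactus M"
| cycle: "cycle_matroid M \<Longrightarrow> connected_cactus M"
| glue: "connected_cactus M \<Longrightarrow> line_matroid N \<or> cycle_matroid N \<Longrightarrow>
    free_gluing M p N q K \<Longrightarrow> connected_cactus K"

definition collinear_rel :: "'a set_system \<Rightarrow> 'a rel" where
  "collinear_rel M = {(p, q). \<exists>l\<in>matroid_lines M. p \<in> l \<and> q \<in> l}"

definition connected_components :: "'a set_system \<Rightarrow> 'a set set" where
  "connected_components M = (\<lambda>p. {q. (p, q) \<in> (collinear_rel M)\<^sup>*}) ` ground M"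

definition cactus_configuration :: "'a set_system \<Rightarrow> bool" where
  "cactus_configuration M \<longleftrightarrow>
     simple_matroid M \<and> matroid_rank M = 3 \<and>
     (\<forall>C\<in>connected_components M. connected_cactus (restriction M C))"

section \<open>The Zariski topology on families of vectors\<close>

text \<open>
  For finite \<open>E\<close> the affine space \<open>(\<complex>\<^sup>3)\<^sup>E\<close> is represented by \<open>E \<rightarrow>\<^sub>E UNIV\<close>, and its polynomial
  functions are the \<open>\<complex>\<close>-algebra generated by the coordinate functions.
\<close>

inductive_set polynomial_funs :: "'a set \<Rightarrow> (('a \<Rightarrow> complex ^ 3) \<Rightarrow> complex) set"
  for E :: "'a set" where
  const: "(\<lambda>\<gamma>. c) \<in> polynomial_funs E"
| coord: "i \<in> E \<Longrightarrow> (\<lambda>\<gamma>. \<gamma> i $ k) \<in> polynomial_funs E"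
| add: "f \<in> polynomial_funs E \<Longrightarrow> g \<in> polynomial_funs E \<Longrightarrow> (\<lambda>\<gamma>. f \<gamma> + g \<gamma>) \<in> polynomial_funs E"
| mult: "f \<in> polynomial_funs E \<Longrightarrow> g \<in> polynomial_funs E \<Longrightarrow> (\<lambda>\<gamma>. f \<gamma> * g \<gamma>) \<in> polynomial_funs E"

definition zero_locus ::
  "'a set \<Rightarrow> (('a \<Rightarrow> complex ^ 3) \<Rightarrow> complex) set \<Rightarrow> ('a \<Rightarrow> complex ^ 3) set" where
  "zero_locus E F = {\<gamma> \<in> E \<rightarrow>\<^sub>E UNIV. \<forall>f\<in>F. f \<gamma> = 0}"

definition zariski_topology :: "'a set \<Rightarrow> ('a \<Rightarrow> complex ^ 3) topology" where
  "zariski_topology E =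
     topology (\<lambda>U. \<exists>F \<subseteq> polynomial_funs E. U = (E \<rightarrow>\<^sub>E UNIV) - zero_locus E F)"

lemma zariski_open_iff:
  "\<gamma> \<in> (E \<rightarrow>\<^sub>E UNIV) - zero_locus E F \<longleftrightarrow> \<gamma> \<in> E \<rightarrow>\<^sub>E UNIV \<and> (\<exists>f\<in>F. f \<gamma> \<noteq> 0)"
  unfolding zero_locus_def by blast

lemma zero_locus_Int:
  "((E \<rightarrow>\<^sub>E UNIV) - zero_locus E F) \<inter> ((E \<rightarrow>\<^sub>E UNIV) - zero_locus E G) =
   (E \<rightarrow>\<^sub>E UNIV) - zero_locus E ((\<lambda>(f, g) \<gamma>. f \<gamma> * g \<gamma>) ` (F \<times> G))"
proof (rule set_eqI)
  fix \<gamma> :: "'a \<Rightarrow> complex ^ 3"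
  have "(\<exists>h\<in>(\<lambda>(f, g) \<gamma>. f \<gamma> * g \<gamma>) ` (F \<times> G). h \<gamma> \<noteq> 0) \<longleftrightarrow>
    (\<exists>f\<in>F. f \<gamma> \<noteq> 0) \<and> (\<exists>g\<in>G. g \<gamma> \<noteq> 0)"
    by (simp add: bex_simps(7) Bex_def split_paired_Ex) blast
  then show "\<gamma> \<in> ((E \<rightarrow>\<^sub>E UNIV) - zero_locus E F) \<inter> ((E \<rightarrow>\<^sub>E UNIV) - zero_locus E G) \<longleftrightarrow>
    \<gamma> \<in> (E \<rightarrow>\<^sub>E UNIV) - zero_locus E ((\<lambda>(f, g) \<gamma>. f \<gamma> * g \<gamma>) ` (F \<times> G))"
    unfolding Int_iff zariski_open_iff by argo
qed

lemma zero_locus_Union: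
  "(\<Union>U\<in>\<U>. (E \<rightarrow>\<^sub>E UNIV) - zero_locus E (\<phi> U)) = (E \<rightarrow>\<^sub>E UNIV) - zero_locus E (\<Union> (\<phi> ` \<U>))"
  by (rule set_eqI) (simp only: UN_iff zariski_open_iff, blast)

lemma istopology_zariski:
  "istopology (\<lambda>U. \<exists>F \<subseteq> polynomial_funs E. U = (E \<rightarrow>\<^sub>E UNIV) - zero_locus E F)"
  unfolding istopology_def
proof (intro conjI allI impI)
  fix U V
  assume "\<exists>F \<subseteq> polynomial_funs E. U = (E \<rightarrow>\<^sub>E UNIV) - zero_locus E F"
    and "\<exists>F \<subseteq> polynomial_funs E. V = (E \<rightarrow>\<^sub>E UNIV) - zero_locus E F"
  then obtain F G where F: "F \<subseteq> polynomial_funs E" "U = (E \<rightarrow>\<^sub>E UNIV) - zero_locus E F"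
    and G: "G \<subseteq> polynomial_funs E" "V = (E \<rightarrow>\<^sub>E UNIV) - zero_locus E G"
    by (elim exE conjE) (rule that)
  have "(\<lambda>(f, g) \<gamma>. f \<gamma> * g \<gamma>) ` (F \<times> G) \<subseteq> polynomial_funs E"
    using F(1) G(1) by (auto intro: polynomial_funs.mult)
  then show "\<exists>H \<subseteq> polynomial_funs E. U \<inter> V = (E \<rightarrow>\<^sub>E UNIV) - zero_locus E H"
    unfolding F(2) G(2) zero_locus_Int
    by (intro exI[of _ "(\<lambda>(f, g) \<gamma>. f \<gamma> * g \<gamma>) ` (F \<times> G)"] conjI refl)
next
  fix \<U> :: "('a \<Rightarrow> complex ^ 3) set set"
  assume "\<forall>U\<in>\<U>. \<exists>F \<subseteq> polynomial_funs E. U = (E \<rightarrow>\<^sub>E UNIV) - zero_locus E F"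
  then obtain \<phi> where \<phi>: "\<forall>U\<in>\<U>. \<phi> U \<subseteq> polynomial_funs E \<and> U = (E \<rightarrow>\<^sub>E UNIV) - zero_locus E (\<phi> U)"
    unfolding bchoice_iff by (elim exE) (rule that)
  have "\<Union>\<U> = (\<Union>U\<in>\<U>. (E \<rightarrow>\<^sub>E UNIV) - zero_locus E (\<phi> U))"
    using \<phi> by (subst image_ident[symmetric, of \<U>], intro SUP_cong refl) (rule conjunct2, rule bspec)
  then have "\<Union>\<U> = (E \<rightarrow>\<^sub>E UNIV) - zero_locus E (\<Union> (\<phi> ` \<U>))"
    unfolding zero_locus_Union .
  moreover have "\<Union> (\<phi> ` \<U>) \<subseteq> polynomial_funs E"
    using \<phi> by (intro UN_least) (rule conjunct1, rule bspec)
  ultimately show "\<exists>H \<subseteq> polynomial_funs E. \<Union>\<U> = (E \<rightarrow>\<^sub>E UNIV) - zero_locus E H"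
    by (intro exI[of _ "\<Union> (\<phi> ` \<U>)"] conjI)
qed

lemma openin_zariski:
  "openin (zariski_topology E) U \<longleftrightarrow>
     (\<exists>F \<subseteq> polynomial_funs E. U = (E \<rightarrow>\<^sub>E UNIV) - zero_locus E F)"
  unfolding zariski_topology_def topology_inverse'[OF istopology_zariski] ..

lemma topspace_zariski: "topspace (zariski_topology E) = (E \<rightarrow>\<^sub>E UNIV)"
proof (rule antisym)
  show "topspace (zariski_topology E) \<subseteq> E \<rightarrow>\<^sub>E UNIV"
    using openin_topspace[of "zariski_topology E"] unfolding openin_zariski
    by (elim exE conjE) (simp only: Diff_subset)
  have "zero_locus E {\<lambda>\<gamma>. 1} = {}"
    by (simp add: zero_locus_def)
  then have "openin (zariski_topology E) (E \<rightarrow>\<^sub>E UNIV)"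
    unfolding openin_zariski
    by (intro exI[of _ "{\<lambda>\<gamma>. 1}"]) (simp add: polynomial_funs.const)
  then show "E \<rightarrow>\<^sub>E UNIV \<subseteq> topspace (zariski_topology E)"
    by (rule openin_subset)
qed

lemma closedin_zariski:
  "closedin (zariski_topology E) Z \<longleftrightarrow> (\<exists>F \<subseteq> polynomial_funs E. Z = zero_locus E F)"
proof -
  have sub: "zero_locus E F \<subseteq> E \<rightarrow>\<^sub>E UNIV" for F
    unfolding zero_locus_def by (rule Collect_restrict)
  have "Z \<subseteq> E \<rightarrow>\<^sub>E UNIV \<and> (E \<rightarrow>\<^sub>E UNIV) - Z = (E \<rightarrow>\<^sub>E UNIV) - zero_locus E F \<longleftrightarrow>
      Z = zero_locus E F" for F
    using double_diff[OF sub[of F] subset_refl] double_diff[of Z "E \<rightarrow>\<^sub>E UNIV", OF _ subset_refl]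
      sub[of F] by (intro iffI) simp_all
  then show ?thesis
    unfolding closedin_def topspace_zariski openin_zariski
    by (simp add: conj_left_commute ex_simps(2)[symmetric] del: ex_simps)
qed

definition irreducible_in :: "'a topology \<Rightarrow> 'a set \<Rightarrow> bool" where
  "irreducible_in X S \<longleftrightarrow>
     S \<subseteq> topspace X \<and> S \<noteq> {} \<and>
     (\<forall>A B. closedin X A \<and> closedin X B \<and> S \<subseteq> A \<union> B \<longrightarrow> S \<subseteq> A \<or> S \<subseteq> B)"

section \<open>Realizations\<close>

text \<open>
  Linear dependence of \<open>\<gamma>\<close> restricted to \<open>S\<close> as a family: a repeated vector makes it dependent,
  even if the set \<open>\<gamma> ` S\<close> of its values is independent.
\<close>

definition dependent_family :: "('a \<Rightarrow> complex ^ 3) \<Rightarrow> 'a set \<Rightarrow> bool" where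
  "dependent_family \<gamma> S \<longleftrightarrow> \<not> inj_on \<gamma> S \<or> vec.dependent (\<gamma> ` S)"

definition realizations :: "'a set_system \<Rightarrow> ('a \<Rightarrow> complex ^ 3) set" where
  "realizations M =
     {\<gamma> \<in> ground M \<rightarrow>\<^sub>E UNIV. \<forall>S. S \<subseteq> ground M \<longrightarrow> (dep M S \<longleftrightarrow> dependent_family \<gamma> S)}"

definition matroid_variety :: "'a set_system \<Rightarrow> ('a \<Rightarrow> complex ^ 3) set" where
  "matroid_variety M = zariski_topology (ground M) closure_of realizations M"

end

(* The points of a cactus configuration can be ordered so that every new point lies on at most one
   line through two earlier points.  So a configuration is built by placing each new point either
   anywhere or on the span of two points already placed, which fixes all required dependencies;
   a generic choice avoids the others, and realizations exist.  Any two realizations are joined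
   along the same construction by interpolating the free parameters linearly.  This gives a
   polynomial curve whose members all satisfy the required dependencies, hence are realizations
   for all but finitely many parameter values.  Two polynomial functions not vanishing identically
   on the realization space are therefore simultaneously nonzero at some realization. *)

theory Submission
  imports Defs
begin

section \<open>Dependence in three-space\<close>

text \<open>The delicate point is the ordering. In a cycle each \<open>p i\<close> lies on two
  lines, and a gluing dictates the point from which the new block has to grow. Orderings are
  therefore taken relative to a start set, and a line or cycle is shown to grow from any one of its
  points. A new block meets the old points only in the gluing point, and a new component not at all,
  so the lines of the one never see two points of the other, and orderings can be concatenated. A
  single confining line per new point is what makes interpolation work: a vector confined to two
  spans would have to follow their moving intersection, which interpolating coefficients in one span
  does not do in general. For irreducibility, two closed sets that cover the closure while neither
  contains it would each miss a realization, where one of its defining polynomials is nonzero;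
  joining these two realizations gives a point outside both. All conditions other than the required
  dependencies are finitely many polynomial inequations, each valid at an endpoint of the curve, so
  over an infinite field they hold together for some parameter.\<close>

definition det3 :: "complex ^ 3 \<Rightarrow> complex ^ 3 \<Rightarrow> complex ^ 3 \<Rightarrow> complex" where
  "det3 u v w = det (vector [u, v, w] :: complex ^ 3 ^ 3)"

lemma det3_expand:
  "det3 u v w = u $ 1 * (v $ 2 * w $ 3 - v $ 3 * w $ 2) - u $ 2 * (v $ 1 * w $ 3 - v $ 3 * w $ 1)
    + u $ 3 * (v $ 1 * w $ 2 - v $ 2 * w $ 1)"
  by (simp add: det3_def det_3 algebra_simps)

lemma det3_repeat [simp]: "det3 u u w = 0" "det3 u v v = 0" "det3 u v u = 0"
  by (simp_all add: det3_expand algebra_simps)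

lemma det3_swap: "det3 v u w = - det3 u v w" "det3 u w v = - det3 u v w"
  by (simp_all add: det3_expand algebra_simps)

lemma det3_rotate: "det3 v w u = det3 u v w" "det3 w u v = det3 u v w"
  by (simp_all add: det3_expand algebra_simps)

lemma det3_linear:
  "det3 (s *s u + t *s v) w x = s * det3 u w x + t * det3 v w x"
  "det3 w (s *s u + t *s v) x = s * det3 w u x + t * det3 w v x"
  "det3 w x (s *s u + t *s v) = s * det3 w x u + t * det3 w x v"
  by (simp_all add: det3_expand algebra_simps)

lemma det3_cramer:
  "det3 u v w *s x = det3 x v w *s u + det3 u x w *s v + det3 u v x *s w"
  by (simp add: vec_eq_iff forall_3 det3_expand algebra_simps)

text \<open>\<open>w\<close> only certifies that \<open>u\<close> and \<open>v\<close> are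
  independent: in \<open>det3_cramer\<close> the coefficient of \<open>w\<close> is
  \<open>det3 u v x\<close>, which vanishes, and dividing by \<open>det3 u v w\<close> leaves a
  combination of \<open>u\<close> and \<open>v\<close>.\<close>

lemma det3_span2:
  assumes "det3 u v w \<noteq> 0" "det3 u v x = 0"
  obtains s t where "x = s *s u + t *s v"
proof
  have "det3 u v w *s x = det3 x v w *s u + det3 u x w *s v"
    using det3_cramer[of u v w x] assms(2) by simp
  then have "(1 / det3 u v w) *s (det3 u v w *s x) =
      (1 / det3 u v w) *s (det3 x v w *s u + det3 u x w *s v)"
    by simp
  then show "x = (det3 x v w / det3 u v w) *s u + (det3 u x w / det3 u v w) *s v"
    using assms(1) by (simp add: vec_eq_iff algebra_simps)
qed

text \<open>If every \<open>det3 u v w\<close> vanishes, the basis vectors as \<open>w\<close> show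
  that all 2x2 minors of the pair vanish, and the minors yield explicit linear relations. The
  witness form is chosen because, once \<open>w\<close> is fixed, independence of a pair becomes the
  nonvanishing of one polynomial.\<close>

lemma combination2_trivial_iff:
  "(\<forall>a b. a *s u + b *s v = 0 \<longrightarrow> a = 0 \<and> b = 0) \<longleftrightarrow> (\<exists>w. det3 u v w \<noteq> 0)"
proof
  assume L: "\<forall>a b. a *s u + b *s v = 0 \<longrightarrow> a = 0 \<and> b = 0"
  show "\<exists>w. det3 u v w \<noteq> 0"
  proof (rule ccontr)
    assume "\<nexists>w. det3 u v w \<noteq> 0"
    then have z: "det3 u v (axis k 1) = 0" for k
      by blast
    have "v $ i * u $ j = u $ i * v $ j" for i j
    proof -
      have "v $ 2 * u $ 3 = u $ 2 * v $ 3" "v $ 1 * u $ 3 = u $ 1 * v $ 3" "v $ 1 * u $ 2 = u $ 1 * v $ 2"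
        using z[of 1] z[of 2] z[of 3] by (simp_all add: det3_expand axis_def algebra_simps)
      then show ?thesis
        using exhaust_3[of i] exhaust_3[of j] by (auto simp: mult.commute)
    qed
    then have minors: "v $ k *s u + (- (u $ k)) *s v = 0" for k
      by (simp add: vec_eq_iff)
    then have "v = 0"
      using L by (metis vec_eq_iff zero_index)
    then show False
      using L[rule_format, of 0 1] by simp
  qed
next
  assume "\<exists>w. det3 u v w \<noteq> 0"
  then obtain w where w: "det3 u v w \<noteq> 0" by blast
  show "\<forall>a b. a *s u + b *s v = 0 \<longrightarrow> a = 0 \<and> b = 0"
  proof (intro allI impI)
    fix a b assume "a *s u + b *s v = 0"
    then have "det3 (a *s u + b *s v) v w = 0" "det3 u (a *s u + b *s v) w = 0"
      by (simp_all add: det3_expand)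
    moreover have "det3 (a *s u + b *s v) v w = a * det3 u v w"
      "det3 u (a *s u + b *s v) w = b * det3 u v w"
      by (simp_all add: det3_linear(1,2) del: vec.scale_zero_left)
    ultimately show "a = 0 \<and> b = 0"
      using w by simp
  qed
qed

lemma combination3_trivial_iff:
  "(\<forall>a b c. a *s u + b *s v + c *s w = 0 \<longrightarrow> a = 0 \<and> b = 0 \<and> c = 0) \<longleftrightarrow> det3 u v w \<noteq> 0"
proof
  assume L: "\<forall>a b c. a *s u + b *s v + c *s w = 0 \<longrightarrow> a = 0 \<and> b = 0 \<and> c = 0"
  have "\<forall>a b. a *s u + b *s v = 0 \<longrightarrow> a = 0 \<and> b = 0"
    using L[rule_format, of _ _ 0] by simp
  then obtain x where x: "det3 u v x \<noteq> 0"
    using combination2_trivial_iff by blast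
  show "det3 u v w \<noteq> 0"
  proof
    assume "det3 u v w = 0"
    then obtain s t where "w = s *s u + t *s v"
      using det3_span2[OF x] by metis
    then show False
      using L[rule_format, of s t "-1"] by simp
  qed
next
  assume nz: "det3 u v w \<noteq> 0"
  show "\<forall>a b c. a *s u + b *s v + c *s w = 0 \<longrightarrow> a = 0 \<and> b = 0 \<and> c = 0"
  proof (intro allI impI)
    fix a b c
    let ?y = "a *s u + b *s v + c *s w"
    assume "?y = 0"
    then have "det3 ?y v w = 0" "det3 u ?y w = 0" "det3 u v ?y = 0"
      by (simp_all add: det3_expand)
    moreover have "det3 ?y v w = a * det3 u v w" "det3 u ?y w = b * det3 u v w"
      "det3 u v ?y = c * det3 u v w"
      by (simp_all add: det3_expand algebra_simps)
    ultimately show "a = 0 \<and> b = 0 \<and> c = 0"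
      using nz by simp
  qed
qed

text \<open>Coefficients indexed by elements instead of by vectors account for repetitions: two
  equal members carry the coefficients 1 and -1. In the injective case the two kinds of coefficients
  correspond under \<open>\<gamma>\<close>.\<close>

lemma dependent_family_iff:
  assumes "finite S"
  shows "dependent_family \<gamma> S \<longleftrightarrow> (\<exists>c. (\<Sum>i\<in>S. c i *s \<gamma> i) = 0 \<and> (\<exists>i\<in>S. c i \<noteq> 0))"
proof (cases "inj_on \<gamma> S")
  case True
  have "(\<exists>u. (\<exists>v\<in>\<gamma> ` S. u v \<noteq> 0) \<and> (\<Sum>v\<in>\<gamma> ` S. u v *s v) = 0) \<longleftrightarrow>
      (\<exists>c. (\<Sum>i\<in>S. c i *s \<gamma> i) = 0 \<and> (\<exists>i\<in>S. c i \<noteq> 0))" (is "?L \<longleftrightarrow> ?R")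
  proof
    assume ?L
    then obtain u where u: "\<exists>v\<in>\<gamma> ` S. u v \<noteq> 0" "(\<Sum>v\<in>\<gamma> ` S. u v *s v) = 0" by blast
    then have "(\<Sum>i\<in>S. (u \<circ> \<gamma>) i *s \<gamma> i) = 0" "\<exists>i\<in>S. (u \<circ> \<gamma>) i \<noteq> 0"
      by (auto simp: sum.reindex[OF True])
    then show ?R by blast
  next
    assume ?R
    then obtain c where c: "(\<Sum>i\<in>S. c i *s \<gamma> i) = 0" "\<exists>i\<in>S. c i \<noteq> 0" by blast
    define u where "u = c \<circ> inv_into S \<gamma>"
    have u: "u (\<gamma> i) = c i" if "i \<in> S" for i
      using that True by (simp add: u_def)
    have "(\<Sum>v\<in>\<gamma> ` S. u v *s v) = (\<Sum>i\<in>S. u (\<gamma> i) *s \<gamma> i)"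
      by (simp add: sum.reindex[OF True])
    also have "\<dots> = 0" using u c(1) by simp
    finally show ?L using c(2) u by (intro exI[of _ u]) auto
  qed
  then show ?thesis
    using True assms by (simp add: dependent_family_def vec.dependent_finite)
next
  case False
  then obtain i j where ij: "i \<in> S" "j \<in> S" "i \<noteq> j" "\<gamma> i = \<gamma> j"
    by (auto simp: inj_on_def)
  define c where "c = (\<lambda>_. 0)(i := 1, j := - 1 :: complex)"
  have "(\<Sum>k\<in>S. c k *s \<gamma> k) = (\<Sum>k\<in>{i, j}. c k *s \<gamma> k)"
    using assms ij by (intro sum.mono_neutral_right) (auto simp: c_def)
  also have "\<dots> = 0" using ij by (simp add: c_def)
  finally have "(\<Sum>k\<in>S. c k *s \<gamma> k) = 0" .
  moreover have "c i \<noteq> 0" using ij by (simp add: c_def)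
  ultimately show ?thesis
    using False ij(1) unfolding dependent_family_def by blast
qed

lemma dependent_family_singleton: "dependent_family \<gamma> {i} \<longleftrightarrow> \<gamma> i = 0"
  by (auto simp: dependent_family_def vec.dependent_single)

lemma dependent_family_doubleton:
  assumes "i \<noteq> j"
  shows "dependent_family \<gamma> {i, j} \<longleftrightarrow> (\<forall>w. det3 (\<gamma> i) (\<gamma> j) w = 0)"
proof -
  have fam: "(\<exists>c. P (c i) (c j)) \<longleftrightarrow> (\<exists>a b. P a b)" for P :: "complex \<Rightarrow> complex \<Rightarrow> bool"
  proof
    assume "\<exists>a b. P a b"
    then obtain a b where "P a b" by blast
    then show "\<exists>c. P (c i) (c j)"
      using assms by (intro exI[of _ "(\<lambda>_. 0)(i := a, j := b)"]) auto
  qed blast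
  then show ?thesis
    using combination2_trivial_iff[of "\<gamma> i" "\<gamma> j"] assms
      fam[of "\<lambda>a b. a *s \<gamma> i + b *s \<gamma> j = 0 \<and> (a \<noteq> 0 \<or> b \<noteq> 0)"]
    by (simp add: dependent_family_iff) metis
qed

lemma dependent_family_triple:
  assumes "i \<noteq> j" "i \<noteq> k" "j \<noteq> k"
  shows "dependent_family \<gamma> {i, j, k} \<longleftrightarrow> det3 (\<gamma> i) (\<gamma> j) (\<gamma> k) = 0"
proof -
  have fam: "(\<exists>c. P (c i) (c j) (c k)) \<longleftrightarrow> (\<exists>a b c. P a b c)"
    for P :: "complex \<Rightarrow> complex \<Rightarrow> complex \<Rightarrow> bool"
  proof
    assume "\<exists>a b c. P a b c"
    then obtain a b c where "P a b c" by blast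
    then show "\<exists>c. P (c i) (c j) (c k)"
      using assms by (intro exI[of _ "(\<lambda>_. 0)(i := a, j := b, k := c)"]) auto
  qed blast
  then show ?thesis
    using combination3_trivial_iff[of "\<gamma> i" "\<gamma> j" "\<gamma> k"] assms
      fam[of "\<lambda>a b c. a *s \<gamma> i + b *s \<gamma> j + c *s \<gamma> k = 0 \<and> (a \<noteq> 0 \<or> b \<noteq> 0 \<or> c \<noteq> 0)"]
    by (simp add: dependent_family_iff add.assoc[symmetric]) metis
qed

lemma dependent_family_large:
  assumes "card S > 3"
  shows "dependent_family \<gamma> S"
proof (cases "inj_on \<gamma> S")
  case True
  have "vec.dim (\<gamma> ` S) \<le> 3"
    using vec.dim_subset_UNIV[of "\<gamma> ` S"] by (simp add: vec.dimension_def card_cart_basis)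
  then show ?thesis
    using assms card_image[OF True] vec.independent_card_le_dim[OF order_refl, of "\<gamma> ` S"]
    by (fastforce simp: dependent_family_def)
qed (simp add: dependent_family_def)

section \<open>Construction sequences of cactus configurations\<close>

text \<open>A finite partial linear space with blocks of size at least three. It isolates what is
  used about the lines of a simple matroid, so that it can also be established for a free gluing, of
  which only the independent sets are specified.\<close>

definition linear_system :: "'a set \<Rightarrow> 'a set set \<Rightarrow> bool" where
  "linear_system E L \<longleftrightarrow> finite E \<and> (\<forall>l\<in>L. l \<subseteq> E \<and> 3 \<le> card l) \<and>
     (\<forall>l\<in>L. \<forall>l'\<in>L. \<forall>a\<in>l \<inter> l'. \<forall>b\<in>l \<inter> l'. a \<noteq> b \<longrightarrow> l = l')"

lemma linear_systemI:
  assumes "finite E" "\<And>l. l \<in> L \<Longrightarrow> l \<subseteq> E" "\<And>l. l \<in> L \<Longrightarrow> 3 \<le> card l"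
    and "\<And>l l' a b. l \<in> L \<Longrightarrow> l' \<in> L \<Longrightarrow> a \<in> l \<Longrightarrow> a \<in> l' \<Longrightarrow> b \<in> l \<Longrightarrow> b \<in> l' \<Longrightarrow> a \<noteq> b \<Longrightarrow> l = l'"
  shows "linear_system E L"
  unfolding linear_system_def
proof (intro conjI ballI impI)
  show "l = l'" if "l \<in> L" "l' \<in> L" "a \<in> l \<inter> l'" "b \<in> l \<inter> l'" "a \<noteq> b" for l l' a b
    using that by (intro assms(4)[of l l' a b]) auto
qed (simp_all add: assms(1-3))

lemma linear_systemD:
  assumes "linear_system E L"
  shows "finite E" "l \<in> L \<Longrightarrow> l \<subseteq> E" "l \<in> L \<Longrightarrow> 3 \<le> card l"
  using assms by (simp_all add: linear_system_def)

lemma linear_system_unique: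
  assumes "linear_system E L" "l \<in> L" "l' \<in> L" "a \<in> l" "a \<in> l'" "b \<in> l" "b \<in> l'" "a \<noteq> b"
  shows "l = l'"
  using assms unfolding linear_system_def by (meson IntI)

text \<open>A line with fewer than two points in \<open>A\<close> puts no condition on the vector of
  \<open>x\<close>, whereas a line with two confines it to their span. Uniqueness of the confining
  line lets a choice in one span satisfy all forced dependencies.\<close>

definition addable :: "'a set set \<Rightarrow> 'a set \<Rightarrow> 'a \<Rightarrow> bool" where
  "addable L A x \<longleftrightarrow>
     (\<forall>l\<in>L. \<forall>l'\<in>L. x \<in> l \<and> x \<in> l' \<and> (\<exists>u\<in>l \<inter> A. \<exists>v\<in>l \<inter> A. u \<noteq> v) \<and>
        (\<exists>u\<in>l' \<inter> A. \<exists>v\<in>l' \<inter> A. u \<noteq> v) \<longrightarrow> l = l')"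

text \<open>The start set is a parameter because a block is grown from its gluing point, and a
  component on top of the earlier ones.\<close>

inductive built :: "'a set set \<Rightarrow> 'a set \<Rightarrow> 'a set \<Rightarrow> bool" for L A where
  refl: "built L A A"
| step: "built L A B \<Longrightarrow> x \<notin> B \<Longrightarrow> addable L B x \<Longrightarrow> built L A (insert x B)"

section \<open>Concatenation and transport of construction sequences\<close>

lemma built_mono: "built L A B \<Longrightarrow> A \<subseteq> B"
  by (induction rule: built.induct) auto

lemma built_trans: "built L B C \<Longrightarrow> built L A B \<Longrightarrow> built L A C"
  by (induction rule: built.induct) (auto intro: built.step)

lemma built_Un:
  assumes "finite C"
    and "\<And>x B. x \<in> C \<Longrightarrow> x \<notin> B \<Longrightarrow> A \<subseteq> B \<Longrightarrow> B \<subseteq> A \<union> C \<Longrightarrow> addable L B x"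
  shows "built L A (A \<union> C)"
proof -
  have "D \<subseteq> C \<Longrightarrow> built L A (A \<union> D)" if "finite D" for D
    using that
  proof (induction D)
    case empty
    show ?case by (simp add: built.refl)
  next
    case (insert x D)
    show ?case
    proof (cases "x \<in> A")
      case True
      then show ?thesis using insert by (simp add: insert_absorb)
    next
      case False
      then have "built L A (insert x (A \<union> D))"
        using insert by (intro built.step assms(2)) auto
      then show ?thesis by simp
    qed
  qed
  then show ?thesis using assms(1) by blast
qed

lemma built_singleton: "built L {} {x}"
  using built.step[OF built.refl, of x "{}" L] by (simp add: addable_def)

text \<open>Grows a new block beside the old points \<open>F\<close>. A line through a new point
  meets \<open>F\<close> only inside \<open>A\<close>, so \<open>F\<close> supplies no further
  earlier points on it, and addability within the block carries over.\<close>

lemma built_extend: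
  assumes "built L' A B" and "F \<inter> B \<subseteq> A"
    and "\<And>l x. l \<in> L \<Longrightarrow> x \<in> B - A \<Longrightarrow> x \<in> l \<Longrightarrow> l \<in> L' \<and> l \<inter> F \<subseteq> A"
  shows "built L (F \<union> A) (F \<union> B)"
  using assms
proof (induction rule: built.induct)
  case refl
  show ?case by (rule built.refl)
next
  case (step B x)
  have AB: "A \<subseteq> B" using built_mono step.hyps(1) .
  have loc: "l \<in> L' \<and> l \<inter> (F \<union> B) \<subseteq> B" if "l \<in> L" "x \<in> l" for l
    using step.prems(2)[of l x] step.hyps(2) that AB by blast
  have "addable L (F \<union> B) x"
    unfolding addable_def
  proof (intro ballI impI, elim conjE)
    fix l l'
    assume l: "l \<in> L" "l' \<in> L" "x \<in> l" "x \<in> l'"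
      and "\<exists>u\<in>l \<inter> (F \<union> B). \<exists>v\<in>l \<inter> (F \<union> B). u \<noteq> v"
      and "\<exists>u\<in>l' \<inter> (F \<union> B). \<exists>v\<in>l' \<inter> (F \<union> B). u \<noteq> v"
    then have "\<exists>u\<in>l \<inter> B. \<exists>v\<in>l \<inter> B. u \<noteq> v" "\<exists>u\<in>l' \<inter> B. \<exists>v\<in>l' \<inter> B. u \<noteq> v"
      using loc[of l] loc[of l'] by blast+
    then show "l = l'"
      using step.hyps(3) l loc[of l] loc[of l'] unfolding addable_def by blast
  qed
  moreover have "x \<notin> F \<union> B" using step.prems(1) step.hyps(2) AB by blast
  moreover have "built L (F \<union> A) (F \<union> B)"
    using step.prems by (intro step.IH) blast+
  ultimately show ?case
    using built.step[of L "F \<union> A" "F \<union> B" x] by simp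
qed

text \<open>An additional line meets \<open>B\<close> in at most one point, so it never carries two
  earlier points and never enters the condition in \<open>addable\<close>.\<close>

lemma built_more_lines:
  assumes "built L A B" and "\<And>l. l \<in> L' - L \<Longrightarrow> \<exists>x. l \<inter> B \<subseteq> {x}"
  shows "built L' A B"
  using assms
proof (induction rule: built.induct)
  case refl
  show ?case by (rule built.refl)
next
  case (step B x)
  have "l \<in> L" if "l \<in> L'" "\<exists>u\<in>l \<inter> B. \<exists>v\<in>l \<inter> B. u \<noteq> v" for l
    using that step.prems[of l] by blast
  then have "addable L' B x"
    using step.hyps(3) unfolding addable_def by blast
  moreover have "built L' A B"
    using step.prems by (intro step.IH) blast
  ultimately show ?case
    using step.hyps(2) by (intro built.step)
qed

lemma built_image:
  assumes "built L A B" and "inj_on f E" and "B \<subseteq> E" and "\<And>l. l \<in> L \<Longrightarrow> l \<subseteq> E"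
  shows "built ((`) f ` L) (f ` A) (f ` B)"
  using assms
proof (induction rule: built.induct)
  case refl
  show ?case by (rule built.refl)
next
  case (step B x)
  have x: "x \<in> E" and B: "B \<subseteq> E" using step.prems by auto
  have iff: "f y \<in> f ` l \<longleftrightarrow> y \<in> l" if "l \<in> L" "y \<in> E" for l y
    using inj_on_image_mem_iff[OF step.prems(1) that(2)] step.prems(3)[OF that(1)] .
  have two: "\<exists>u\<in>l \<inter> B. \<exists>v\<in>l \<inter> B. u \<noteq> v"
    if l: "l \<in> L" and uv: "\<exists>u\<in>f ` l \<inter> f ` B. \<exists>v\<in>f ` l \<inter> f ` B. u \<noteq> v" for l
  proof -
    obtain y z where "y \<in> f ` l" "y \<in> f ` B" "z \<in> f ` l" "z \<in> f ` B" "y \<noteq> z"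
      using uv by blast
    moreover from this obtain a b where "a \<in> B" "y = f a" "b \<in> B" "z = f b" by blast
    ultimately show ?thesis using iff[OF l] B by (metis IntI subsetD)
  qed
  have "addable ((`) f ` L) (f ` B) (f x)"
    unfolding addable_def
  proof (intro ballI impI, elim conjE)
    fix m m'
    assume m: "m \<in> (`) f ` L" "m' \<in> (`) f ` L" "f x \<in> m" "f x \<in> m'"
      and t: "\<exists>u\<in>m \<inter> f ` B. \<exists>v\<in>m \<inter> f ` B. u \<noteq> v" "\<exists>u\<in>m' \<inter> f ` B. \<exists>v\<in>m' \<inter> f ` B. u \<noteq> v"
    from m obtain l l' where l: "l \<in> L" "m = f ` l" "l' \<in> L" "m' = f ` l'" by blast
    have "x \<in> l" "x \<in> l'" using l m iff x by auto
    moreover have "\<exists>u\<in>l \<inter> B. \<exists>v\<in>l \<inter> B. u \<noteq> v" "\<exists>u\<in>l' \<inter> B. \<exists>v\<in>l' \<inter> B. u \<noteq> v"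
      using two l t by auto
    ultimately have "l = l'"
      using step.hyps(3) l unfolding addable_def by blast
    then show "m = m'" using l by simp
  qed
  moreover have "f x \<notin> f ` B"
    using inj_on_image_mem_iff[OF step.prems(1) x B] step.hyps(2) by simp
  ultimately show ?case
    using built.step[of "(`) f ` L" "f ` A" "f ` B" "f x"] step.IH step.prems by simp
qed

lemma linear_system_image:
  assumes sys: "linear_system E L" and inj: "inj_on f E"
  shows "linear_system (f ` E) ((`) f ` L)"
proof (rule linear_systemI)
  note sub = linear_systemD(2)[OF sys]
  show "finite (f ` E)" using linear_systemD(1)[OF sys] by simp
  show "m \<subseteq> f ` E" "3 \<le> card m" if m: "m \<in> (`) f ` L" for m
  proof -
    obtain l where l: "l \<in> L" "m = f ` l" using m by blast
    then show "m \<subseteq> f ` E" using sub by blast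
    have "card m = card l" using l sub[OF l(1)] inj by (metis card_image inj_on_subset)
    then show "3 \<le> card m" using linear_systemD(3)[OF sys l(1)] by simp
  qed
  fix m m' u v
  assume m: "m \<in> (`) f ` L" "m' \<in> (`) f ` L" and uv: "u \<in> m" "u \<in> m'" "v \<in> m" "v \<in> m'" "u \<noteq> v"
  obtain l l' where l: "l \<in> L" "m = f ` l" "l' \<in> L" "m' = f ` l'" using m by blast
  obtain a b where ab: "a \<in> l" "u = f a" "b \<in> l" "v = f b" using uv l by blast
  then have "a \<in> E" "b \<in> E" using sub[OF l(1)] by blast+
  then have "a \<in> l'" "b \<in> l'"
    using uv l ab inj_on_image_mem_iff[OF inj _ sub[OF l(3)]] by simp_all
  moreover have "a \<noteq> b" using ab uv by blast
  ultimately have "l = l'"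
    using linear_system_unique[OF sys l(1,3)] ab by blast
  then show "m = m'" using l by simp
qed

lemma linear_system_Un:
  assumes E: "linear_system E L" and F: "linear_system F K" and EF: "E \<inter> F = {x}"
  shows "linear_system (E \<union> F) (L \<union> K)"
proof (rule linear_systemI)
  have mixed: False if "l \<in> L" "k \<in> K" "a \<in> l" "a \<in> k" "b \<in> l" "b \<in> k" "a \<noteq> b" for l k a b
  proof -
    have "a \<in> E \<inter> F" "b \<in> E \<inter> F"
      using that linear_systemD(2)[OF E] linear_systemD(2)[OF F] by auto
    then show ?thesis using EF that(7) by simp
  qed
  fix l l' a b
  assume "l \<in> L \<union> K" "l' \<in> L \<union> K" and ab: "a \<in> l" "a \<in> l'" "b \<in> l" "b \<in> l'" "a \<noteq> b"
  then consider "l \<in> L" "l' \<in> L" | "l \<in> K" "l' \<in> K" | "l \<in> L" "l' \<in> K" | "l \<in> K" "l' \<in> L"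
    by blast
  then show "l = l'"
    by cases (use ab mixed[of l l' a b] mixed[of l' l a b] linear_system_unique[OF E]
        linear_system_unique[OF F] in metis)+
qed (use linear_systemD[OF E] linear_systemD[OF F] in auto)

section \<open>Lines of a matroid as a linear system\<close>

lemma card_ge_3_obtain:
  assumes "3 \<le> card m"
  obtains a b c where "a \<in> m" "b \<in> m" "c \<in> m" "a \<noteq> b" "a \<noteq> c" "b \<noteq> c"
proof -
  obtain S where "S \<subseteq> m" "card S = 3" using assms obtain_subset_with_card_n by metis
  then show ?thesis using that by (auto simp: card_3_iff)
qed

text \<open>Computes the lines of a free gluing from its independent sets. If \<open>a\<close> and
  \<open>b\<close> are two points of a collinear set, each third point lies with them on a member of
  \<open>L\<close>; all these members share \<open>a\<close> and \<open>b\<close> and so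
  coincide.\<close>

lemma matroid_lines_eq_linear_system:
  assumes sys: "linear_system (ground K) L"
    and indeps: "indeps K = {S. S \<subseteq> ground K \<and> card S \<le> 3 \<and> \<not> (card S = 3 \<and> (\<exists>l\<in>L. S \<subseteq> l))}"
  shows "matroid_lines K = L"
proof -
  have dep3: "dep K S \<longleftrightarrow> (\<exists>l\<in>L. S \<subseteq> l)" if "card S = 3" "S \<subseteq> ground K" for S
    using that unfolding dep_def indeps by simp
  have uniq: "l = l'" if "l \<in> L" "l' \<in> L" "a \<in> l" "a \<in> l'" "b \<in> l" "b \<in> l'" "a \<noteq> b" for l l' a b
    using linear_system_unique[OF sys that] .
  have coll: "collinear_set K l" if l: "l \<in> L" for l
  proof -
    have "l \<subseteq> ground K" "3 \<le> card l" using sys l by (simp_all add: linear_system_def)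
    then show ?thesis using l dep3 unfolding collinear_set_def by blast
  qed
  have cover: "\<exists>l\<in>L. m \<subseteq> l" if m: "collinear_set K m" for m
  proof -
    obtain a b c where abc: "a \<in> m" "b \<in> m" "c \<in> m" "a \<noteq> b" "a \<noteq> c" "b \<noteq> c"
      using card_ge_3_obtain[of m] m unfolding collinear_set_def by metis
    have line: "\<exists>l\<in>L. {a, b, d} \<subseteq> l" if "d \<in> m" "d \<noteq> a" "d \<noteq> b" for d
    proof -
      have "card {a, b, d} = 3" "{a, b, d} \<subseteq> m" using abc that by auto
      then show ?thesis using m dep3[of "{a, b, d}"] unfolding collinear_set_def by blast
    qed
    then obtain l where l: "l \<in> L" "a \<in> l" "b \<in> l" using abc by blast
    have "d \<in> l" if d: "d \<in> m" for d
    proof (cases "d = a \<or> d = b")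
      case False
      then obtain l' where "l' \<in> L" "{a, b, d} \<subseteq> l'" using line[OF d] by blast
      then show ?thesis using uniq[of l' l a b] l abc(4) by simp
    qed (use l in blast)
    then show ?thesis using l by blast
  qed
  have max: "l = l'" if l: "l \<in> L" "l' \<in> L" "l \<subseteq> l'" for l l'
  proof -
    obtain a b c where "a \<in> l" "b \<in> l" "c \<in> l" "a \<noteq> b" "a \<noteq> c" "b \<noteq> c"
      using card_ge_3_obtain[OF linear_systemD(3)[OF sys l(1)]] .
    then show ?thesis using l uniq[OF l(1,2), of a b] by blast
  qed
  show ?thesis
  proof (intro set_eqI iffI)
    fix l assume "l \<in> matroid_lines K"
    then show "l \<in> L"
      using cover coll unfolding matroid_lines_def by fastforce
  next
    fix l assume l: "l \<in> L"
    have "m = l" if "collinear_set K m" "l \<subseteq> m" for m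
      using cover[OF that(1)] max[OF l] that(2) by blast
    then show "l \<in> matroid_lines K"
      using coll[OF l] unfolding matroid_lines_def by blast
  qed
qed

lemma matroid_lines_line_matroid:
  assumes "line_matroid M"
  shows "matroid_lines M = {ground M}"
proof -
  have "collinear_set M (ground M)"
    using assms unfolding line_matroid_def collinear_set_def dep_def by auto
  then show ?thesis
    unfolding matroid_lines_def by (auto simp: collinear_set_def)
qed

text \<open>Two lines sharing \<open>a\<close> and \<open>b\<close> have a collinear union: an
  independent triple in the union would extend \<open>{a, b}\<close> by exchange to an independent
  triple, which lies in one of the two lines since \<open>a\<close> and \<open>b\<close> lie in
  both. Maximality then makes the lines equal.\<close>

lemma linear_system_simple_matroid:
  assumes "simple_matroid M"
  shows "linear_system (ground M) (matroid_lines M)"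
proof -
  have M: "matroid M" using assms by (simp add: simple_matroid_def)
  have fin: "finite (ground M)" using M by (simp add: matroid_def)
  have "l = l'" if l: "l \<in> matroid_lines M" "l' \<in> matroid_lines M"
    and ab: "a \<in> l" "a \<in> l'" "b \<in> l" "b \<in> l'" "a \<noteq> b" for l l' a b
  proof -
    have cl: "collinear_set M l" "collinear_set M l'"
      using l by (auto simp: matroid_lines_def)
    have indep2: "{a, b} \<in> indeps M"
      using assms cl ab unfolding simple_matroid_def dep_def collinear_set_def
      by (metis card_2_iff empty_subsetI insert_subset order_refl subsetD)
    have "dep M S" if S: "S \<subseteq> l \<union> l'" "card S = 3" for S
    proof (rule ccontr)
      assume "\<not> dep M S"
      then have "S \<in> indeps M"
        using S cl unfolding dep_def collinear_set_def by blast
      moreover have "card {a, b} < card S" using ab S by simp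
      ultimately obtain w where w: "w \<in> S - {a, b}" "insert w {a, b} \<in> indeps M"
        using M indep2 unfolding matroid_def by blast
      then have "card (insert w {a, b}) = 3" using ab by simp
      moreover have "insert w {a, b} \<subseteq> l \<or> insert w {a, b} \<subseteq> l'" using w S ab by blast
      ultimately have "dep M (insert w {a, b})" using cl unfolding collinear_set_def by blast
      then show False using w by (simp add: dep_def)
    qed
    moreover have "3 \<le> card (l \<union> l')"
      using cl fin unfolding collinear_set_def
      by (meson card_mono finite_UnI finite_subset le_trans sup_ge1)
    ultimately have "collinear_set M (l \<union> l')"
      using cl unfolding collinear_set_def by blast
    then show "l = l'"
      using l unfolding matroid_lines_def by blast
  qed
  then show ?thesis
    using fin unfolding linear_system_def by (auto simp: matroid_lines_def collinear_set_def)
qed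

section \<open>Line matroids and cycles grown from one point\<close>

lemma Suc_mod_inj:
  assumes "i < n" "j < n" "Suc i mod n = Suc j mod n"
  shows "i = j"
  using assms by (auto simp: mod_Suc split: if_splits)

text \<open>
  Once \<open>q\<close> is placed, the vertices can be added in any order: a line has only two vertices, so it
  constrains a new vertex only if it also passes through the non-vertex \<open>q\<close>, which lies on one line.
\<close>

lemma built_cycle_matroid:
  assumes "cycle_matroid M" "q \<in> ground M"
  shows "built (matroid_lines M) {q} (ground M)"
proof -
  let ?L = "matroid_lines M"
  obtain n and p :: "nat \<Rightarrow> 'a" and l where bij: "bij_betw l {..<n} ?L"
    and vertex': "\<forall>i<n. p i \<in> ground M \<and> lines_through M (p i) = {l i, l (Suc i mod n)}"
    and other': "\<forall>x\<in>ground M - p ` {..<n}. card (lines_through M x) = 1"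
    using assms(1) unfolding cycle_matroid_def by blast
  note vertex = vertex'[rule_format] and other = bspec[OF other']
  let ?V = "p ` {..<n}"
  have fin: "finite (ground M)"
    using assms(1) by (simp add: cycle_matroid_def simple_matroid_def matroid_def)
  have uniq: "m = m'" if "x \<in> ground M - ?V" "m \<in> ?L" "m' \<in> ?L" "x \<in> m" "x \<in> m'" for x m m'
  proof -
    have "m \<in> lines_through M x" "m' \<in> lines_through M x"
      using that by (simp_all add: lines_through_def)
    then show ?thesis using other[OF that(1)] by (metis card_1_singletonE singletonD)
  qed
  have mem: "a = i \<or> a = Suc i mod n" if "i < n" "a < n" "p i \<in> l a" for i a
  proof -
    have "l a \<in> lines_through M (p i)"
      using that bij_betwE[OF bij] by (simp add: lines_through_def)
    then have "l a = l i \<or> l a = l (Suc i mod n)" using vertex[OF that(1)] by blast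
    then show ?thesis
      using bij that unfolding bij_betw_def inj_on_def by auto
  qed
  \<comment> \<open>Among the vertices, \<open>l a\<close> can contain only \<open>p a\<close> and
    \<open>p i\<close> with \<open>Suc i mod n = a\<close>; the latter index is unique, so three
    distinct vertices on one line are impossible.\<close>
  have no3: False if m: "m \<in> ?L" and on: "x \<in> m" "y \<in> m" "z \<in> m"
    and V: "x \<in> ?V" "y \<in> ?V" "z \<in> ?V" and neq: "x \<noteq> y" "x \<noteq> z" "y \<noteq> z" for m x y z
  proof -
    obtain a where a: "a < n" "m = l a" using bij m unfolding bij_betw_def by blast
    obtain i j k where "i < n" "x = p i" "j < n" "y = p j" "k < n" "z = p k"
      using V by blast
    then show False
      using mem[of i a] mem[of j a] mem[of k a] a on neq Suc_mod_inj by metis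
  qed
  have "built ?L {q} ({q} \<union> ?V)"
  proof (rule built_Un)
    fix x B assume x: "x \<in> ?V" "x \<notin> B" "{q} \<subseteq> B" "B \<subseteq> {q} \<union> ?V"
    have q: "q \<in> m \<and> q \<notin> ?V"
      if m: "m \<in> ?L" "x \<in> m" and two: "\<exists>u\<in>m \<inter> B. \<exists>v\<in>m \<inter> B. u \<noteq> v" for m
    proof -
      obtain u v where "u \<in> m" "u \<in> B" "v \<in> m" "v \<in> B" "u \<noteq> v" using two by blast
      then show ?thesis using no3[of m x u v] m x by blast
    qed
    show "addable ?L B x"
      unfolding addable_def
    proof (intro ballI impI, elim conjE)
      fix m m' assume m: "m \<in> ?L" "m' \<in> ?L" "x \<in> m" "x \<in> m'"
        and two: "\<exists>u\<in>m \<inter> B. \<exists>v\<in>m \<inter> B. u \<noteq> v" "\<exists>u\<in>m' \<inter> B. \<exists>v\<in>m' \<inter> B. u \<noteq> v"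
      then show "m = m'"
        using q[OF m(1,3) two(1)] q[OF m(2,4) two(2)] uniq[of q m m'] assms(2) by blast
    qed
  qed simp
  \<comment> \<open>The remaining points are not vertices, hence lie on one line each and are
    addable to any set.\<close>
  moreover have "built ?L ({q} \<union> ?V) (({q} \<union> ?V) \<union> ground M)"
  proof (rule built_Un[OF fin])
    fix x B assume "x \<in> ground M" "x \<notin> B" "{q} \<union> ?V \<subseteq> B"
    then have "x \<in> ground M - ?V" by blast
    then show "addable ?L B x"
      unfolding addable_def using uniq[of x] by simp
  qed
  moreover have "({q} \<union> ?V) \<union> ground M = ground M" using assms(2) vertex by auto
  ultimately show ?thesis using built_trans by metis
qed

lemma linear_system_line_or_cycle:
  assumes "line_matroid N \<or> cycle_matroid N"
  shows "linear_system (ground N) (matroid_lines N)"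
  using assms
proof
  assume "line_matroid N"
  then show ?thesis
    using matroid_lines_line_matroid by (auto simp: linear_system_def line_matroid_def)
next
  assume "cycle_matroid N"
  then show ?thesis
    using linear_system_simple_matroid by (auto simp: cycle_matroid_def)
qed

text \<open>The start \<open>q\<close> is arbitrary because a gluing may take place at any point of
  the block. A line matroid has a single line, so every order works there.\<close>

lemma built_line_or_cycle:
  assumes "line_matroid N \<or> cycle_matroid N" and "q \<in> ground N"
  shows "built (matroid_lines N) {q} (ground N)"
  using assms(1)
proof
  assume N: "line_matroid N"
  then have "built (matroid_lines N) {q} ({q} \<union> ground N)"
    using matroid_lines_line_matroid[OF N]
    by (intro built_Un) (auto simp: line_matroid_def addable_def)
  then show ?thesis using assms(2) by (simp add: insert_absorb)
next
  assume "cycle_matroid N"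
  then show ?thesis using assms(2) by (rule built_cycle_matroid)
qed

section \<open>Free gluings and connected components\<close>

lemma line_or_cycle_nonempty:
  assumes "line_matroid N \<or> cycle_matroid N"
  shows "ground N \<noteq> {}"
proof -
  have "ground N \<noteq> {}" if N: "cycle_matroid N"
  proof -
    obtain n and p :: "nat \<Rightarrow> 'a" where "n \<ge> 3" "\<forall>i<n. p i \<in> ground N"
      using N unfolding cycle_matroid_def by blast
    then show ?thesis by (metis empty_iff gr0I not_numeral_le_zero)
  qed
  then show ?thesis using assms by (auto simp: line_matroid_def)
qed

text \<open>The linear system is carried along in the induction because \<open>free_gluing\<close>
  specifies only independent sets: the lines of \<open>K\<close> are identified through it.\<close>

lemma connected_cactus_built:
  assumes "connected_cactus M"
  shows "linear_system (ground M) (matroid_lines M) \<and> built (matroid_lines M) {} (ground M)"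
  using assms
proof (induction rule: connected_cactus.induct)
  case (line M)
  then obtain q where "q \<in> ground M" using line_or_cycle_nonempty by blast
  then show ?case
    using line linear_system_line_or_cycle built_line_or_cycle built_singleton built_trans by metis
next
  case (cycle M)
  then obtain q where "q \<in> ground M" using line_or_cycle_nonempty by blast
  then show ?case
    using cycle linear_system_line_or_cycle built_line_or_cycle built_singleton built_trans by metis
next
  case (glue M N p q K)
  obtain f g where q: "q \<in> ground N" and inj: "inj_on f (ground M)" "inj_on g (ground N)"
    and P: "f p = g q" "f ` ground M \<inter> g ` ground N = {f p}"
    and K: "ground K = f ` ground M \<union> g ` ground N"
      "indeps K = {S. S \<subseteq> ground K \<and> card S \<le> 3 \<and>
          \<not> (card S = 3 \<and>
             ((\<exists>l\<in>matroid_lines M. S \<subseteq> f ` l) \<or> (\<exists>l\<in>matroid_lines N. S \<subseteq> g ` l)))}"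
    using glue.hyps(3) unfolding free_gluing_def by (elim conjE exE) (rule that)
  let ?LM = "(`) f ` matroid_lines M" and ?LN = "(`) g ` matroid_lines N"
  have sysN: "linear_system (ground N) (matroid_lines N)"
    using linear_system_line_or_cycle glue.hyps(2) .
  have subN: "l \<subseteq> ground N" if "l \<in> matroid_lines N" for l
    using sysN that by (simp add: linear_system_def)
  have subM: "l \<subseteq> ground M" if "l \<in> matroid_lines M" for l
    using glue.IH that by (simp add: linear_system_def)
  have sys: "linear_system (ground K) (?LM \<union> ?LN)"
    unfolding K(1) using glue.IH sysN inj P(2)
    by (intro linear_system_Un linear_system_image) auto
  have lines: "matroid_lines K = ?LM \<union> ?LN"
    using sys by (rule matroid_lines_eq_linear_system) (simp add: K(2) bex_Un)
  have "built ?LM {} (f ` ground M)"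
    using built_image[OF _ inj(1) order_refl, of "matroid_lines M" "{}"] glue.IH subM by simp
  then have base: "built (?LM \<union> ?LN) {} (f ` ground M)"
  proof (rule built_more_lines)
    fix l assume "l \<in> (?LM \<union> ?LN) - ?LM"
    then have "l \<subseteq> g ` ground N" using subN by blast
    then show "\<exists>x. l \<inter> f ` ground M \<subseteq> {x}" using P(2) by blast
  qed
  have eq: "f ` ground M \<union> {f p} = f ` ground M"
    using P(2) by blast
  have "built ?LN {f p} (g ` ground N)"
    using built_image[OF built_line_or_cycle[OF glue.hyps(2) q] inj(2) order_refl subN] P(1) by simp
  \<comment> \<open>The copy of \<open>N\<close> grows from the gluing point next to the copy of
    \<open>M\<close>: lines through its other points come from \<open>N\<close> and meet the copy of
    \<open>M\<close> at most in the gluing point.\<close>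
  then have "built (?LM \<union> ?LN) (f ` ground M \<union> {f p}) (f ` ground M \<union> g ` ground N)"
  proof (rule built_extend)
    show "f ` ground M \<inter> g ` ground N \<subseteq> {f p}" using P(2) by simp
    fix l x assume "l \<in> ?LM \<union> ?LN" "x \<in> g ` ground N - {f p}" "x \<in> l"
    moreover from this have "x \<notin> f ` ground M" using P(2) by blast
    ultimately have "l \<in> ?LN" using subM by blast
    then show "l \<in> ?LN \<and> l \<inter> f ` ground M \<subseteq> {f p}" using subN P(2) by blast
  qed
  then have "built (?LM \<union> ?LN) (f ` ground M) (ground K)"
    unfolding K(1) eq .
  then have "built (?LM \<union> ?LN) {} (ground K)"
    using base by (rule built_trans)
  then show ?case using sys lines by simp
qed

lemma matroid_lines_restriction:
  assumes "l \<in> matroid_lines M" "l \<subseteq> C" "C \<subseteq> ground M"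
  shows "l \<in> matroid_lines (restriction M C)"
proof -
  have "dep (restriction M C) S \<longleftrightarrow> S \<subseteq> C \<and> dep M S" for S
    using assms(3) by (auto simp: dep_def restriction_def)
  then have "collinear_set (restriction M C) m \<longleftrightarrow> m \<subseteq> C \<and> collinear_set M m" for m
    using assms(3) unfolding collinear_set_def by (auto simp: restriction_def)
  then show ?thesis
    using assms(1,2) unfolding matroid_lines_def by blast
qed

text \<open>A line lies inside a single component, so a component can be built next to any set
  disjoint from it. The induction runs over points rather than components; a component meeting the
  earlier ones is already contained in their union.\<close>

lemma cactus_configuration_built:
  assumes "cactus_configuration M"
  shows "built (matroid_lines M) {} (ground M)"
proof -
  let ?L = "matroid_lines M" and ?R = "(collinear_rel M)\<^sup>*"
  let ?C = "\<lambda>p. {q. (p, q) \<in> ?R}"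
  have fin: "finite (ground M)"
    using assms by (simp add: cactus_configuration_def simple_matroid_def matroid_def)
  have sub: "l \<subseteq> ground M" if "l \<in> ?L" for l
    using that by (simp add: matroid_lines_def collinear_set_def)
  have sym: "sym ?R"
    by (rule sym_rtrancl) (auto simp: sym_def collinear_rel_def)
  have C_sub: "?C p \<subseteq> ground M" if p: "p \<in> ground M" for p
  proof
    fix q assume "q \<in> ?C p"
    then have "(p, q) \<in> ?R" by simp
    then show "q \<in> ground M"
      using p by (induction rule: rtrancl_induct) (use sub in \<open>auto simp: collinear_rel_def\<close>)
  qed
  have line_sub: "l \<subseteq> ?C p" if "l \<in> ?L" "x \<in> l" "x \<in> ?C p" for l x p
  proof
    fix y assume "y \<in> l"
    then have "(x, y) \<in> collinear_rel M" using that by (auto simp: collinear_rel_def)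
    then show "y \<in> ?C p" using that(3) by (auto intro: rtrancl_into_rtrancl)
  qed
  have comp: "built ?L F (F \<union> ?C p)" if p: "p \<in> ground M" and disj: "F \<inter> ?C p = {}" for F p
  proof -
    have "?C p \<in> connected_components M" using p by (simp add: connected_components_def)
    then have "connected_cactus (restriction M (?C p))"
      using assms by (simp add: cactus_configuration_def)
    then have "built (matroid_lines (restriction M (?C p))) {} (?C p)"
      using connected_cactus_built by (fastforce simp: restriction_def)
    then have "built ?L (F \<union> {}) (F \<union> ?C p)"
    proof (rule built_extend)
      fix l x assume l: "l \<in> ?L" "x \<in> ?C p - {}" "x \<in> l"
      then have "l \<subseteq> ?C p" using line_sub by blast
      then show "l \<in> matroid_lines (restriction M (?C p)) \<and> l \<inter> F \<subseteq> {}"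
        using matroid_lines_restriction[OF l(1) _ C_sub[OF p]] disj by blast
    qed (use disj in simp)
    then show ?thesis by simp
  qed
  have "built ?L {} (\<Union>p\<in>A. ?C p)" if "finite A" "A \<subseteq> ground M" for A
    using that
  proof (induction A rule: finite_induct)
    case empty
    show ?case by (simp add: built.refl)
  next
    case (insert p A)
    let ?F = "\<Union>p\<in>A. ?C p"
    have IH: "built ?L {} ?F" using insert by simp
    show ?case
    proof (cases "?F \<inter> ?C p = {}")
      case True
      then have "built ?L ?F (?F \<union> ?C p)" using comp insert.prems by simp
      then have "built ?L {} (?F \<union> ?C p)" using IH by (rule built_trans)
      then show ?thesis by (simp add: Un_commute)
    next
      case False
      then obtain a y where a: "a \<in> A" "(a, y) \<in> ?R" "(p, y) \<in> ?R" by blast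
      then have "(a, p) \<in> ?R" using symD[OF sym a(3)] by (meson rtrancl_trans)
      then have "?C p \<subseteq> ?F" using a(1) by (auto intro: rtrancl_trans)
      then show ?thesis using IH by (simp add: sup.absorb2)
    qed
  qed
  from this[OF fin order_refl] have "built ?L {} (\<Union>p\<in>ground M. ?C p)" .
  moreover have "(\<Union>p\<in>ground M. ?C p) = ground M" using C_sub by blast
  ultimately show ?thesis by simp
qed

section \<open>Existence of realizations\<close>

definition polyfun :: "(complex \<Rightarrow> complex) \<Rightarrow> bool" where
  "polyfun h \<longleftrightarrow> (\<exists>p. h = poly p)"

lemma polyfun_const [intro]: "polyfun (\<lambda>z. c)"
  unfolding polyfun_def by (rule exI[of _ "[:c:]"]) (simp add: fun_eq_iff)

lemma polyfun_id [intro]: "polyfun (\<lambda>z. z)"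
  unfolding polyfun_def by (rule exI[of _ "[:0, 1:]"]) (simp add: fun_eq_iff)

lemma polyfun_add [intro]:
  assumes "polyfun f" "polyfun g" shows "polyfun (\<lambda>z. f z + g z)"
proof -
  obtain p q where "f = poly p" "g = poly q" using assms unfolding polyfun_def by blast
  then show ?thesis unfolding polyfun_def by (intro exI[of _ "p + q"]) (simp add: fun_eq_iff)
qed

lemma polyfun_mult [intro]:
  assumes "polyfun f" "polyfun g" shows "polyfun (\<lambda>z. f z * g z)"
proof -
  obtain p q where "f = poly p" "g = poly q" using assms unfolding polyfun_def by blast
  then show ?thesis unfolding polyfun_def by (intro exI[of _ "p * q"]) (simp add: fun_eq_iff)
qed

lemma polyfun_diff [intro]:
  assumes "polyfun f" "polyfun g" shows "polyfun (\<lambda>z. f z - g z)"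
  using polyfun_add[OF assms(1) polyfun_mult[OF polyfun_const[of "-1"] assms(2)]] by simp

lemma polyfun_det3:
  assumes "\<And>k. polyfun (\<lambda>z. U z $ k)" "\<And>k. polyfun (\<lambda>z. V z $ k)" "\<And>k. polyfun (\<lambda>z. W z $ k)"
  shows "polyfun (\<lambda>z. det3 (U z) (V z) (W z))"
  unfolding det3_expand by (intro polyfun_add polyfun_diff polyfun_mult assms)

text \<open>The source of all genericity: one good parameter leaves finitely many bad ones, so
  finitely many such conditions share a good parameter.\<close>

lemma polyfun_finite_zeros:
  assumes "polyfun h" "h a \<noteq> 0"
  shows "finite {z. h z = 0}"
proof -
  obtain p where p: "h = poly p" using assms unfolding polyfun_def by blast
  then have "p \<noteq> 0" using assms(2) by auto
  then show ?thesis using p poly_roots_finite by simp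
qed

text \<open>The determinantal form of a realization, for a partial configuration \<open>A\<close>.
  It stops at triples since four vectors in three-space are always dependent.\<close>

definition realizes :: "'a set set \<Rightarrow> 'a set \<Rightarrow> ('a \<Rightarrow> complex ^ 3) \<Rightarrow> bool" where
  "realizes L A \<gamma> \<longleftrightarrow> (\<forall>i\<in>A. \<gamma> i \<noteq> 0) \<and>
     (\<forall>i\<in>A. \<forall>j\<in>A. i \<noteq> j \<longrightarrow> (\<exists>w. det3 (\<gamma> i) (\<gamma> j) w \<noteq> 0)) \<and>
     (\<forall>i\<in>A. \<forall>j\<in>A. \<forall>k\<in>A. i \<noteq> j \<and> i \<noteq> k \<and> j \<noteq> k \<longrightarrow>
        (det3 (\<gamma> i) (\<gamma> j) (\<gamma> k) = 0 \<longleftrightarrow> (\<exists>l\<in>L. {i, j, k} \<subseteq> l)))"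

lemma realizesD:
  assumes "realizes L A \<gamma>" "i \<in> A"
  shows "\<gamma> i \<noteq> 0"
    and "j \<in> A \<Longrightarrow> i \<noteq> j \<Longrightarrow> \<exists>w. det3 (\<gamma> i) (\<gamma> j) w \<noteq> 0"
    and "j \<in> A \<Longrightarrow> k \<in> A \<Longrightarrow> i \<noteq> j \<Longrightarrow> i \<noteq> k \<Longrightarrow> j \<noteq> k \<Longrightarrow>
      det3 (\<gamma> i) (\<gamma> j) (\<gamma> k) = 0 \<longleftrightarrow> (\<exists>l\<in>L. {i, j, k} \<subseteq> l)"
  using assms by (simp_all add: realizes_def)

lemma realizes_subset: "realizes L A \<gamma> \<Longrightarrow> B \<subseteq> A \<Longrightarrow> realizes L B \<gamma>"
  unfolding realizes_def by (simp add: subset_iff)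

lemma realizes_det3_zero:
  assumes "realizes L A \<gamma>" "l \<in> L" "i \<in> l \<inter> A" "j \<in> l \<inter> A" "k \<in> l \<inter> A"
  shows "det3 (\<gamma> i) (\<gamma> j) (\<gamma> k) = 0"
proof (cases "i \<noteq> j \<and> i \<noteq> k \<and> j \<noteq> k")
  case True
  moreover have "\<exists>l\<in>L. {i, j, k} \<subseteq> l" using assms by blast
  ultimately show ?thesis using assms realizesD(3)[OF assms(1), of i j k] by simp
qed auto

text \<open>The moment curve lies in no plane through the origin.\<close>

lemma moment_curve_det3:
  assumes "det3 u v w \<noteq> 0"
  shows "\<exists>t. det3 u v (vector [1, t, t\<^sup>2]) \<noteq> 0"
proof (rule ccontr)
  assume "\<not> ?thesis"
  then have z: "det3 u v (vector [1, t, t\<^sup>2]) = 0" for t by blast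
  \<comment> \<open>These are the coordinates of the cross product of \<open>u\<close> and
    \<open>v\<close>, so \<open>det3 u v\<close> becomes a linear form; along the moment curve it is
    a polynomial of degree at most two, and zeros at 0, 1 and -1 kill its coefficients.\<close>
  define a b c where "a = u $ 2 * v $ 3 - u $ 3 * v $ 2" and "b = u $ 3 * v $ 1 - u $ 1 * v $ 3"
    and "c = u $ 1 * v $ 2 - u $ 2 * v $ 1"
  have *: "det3 u v x = a * x $ 1 + b * x $ 2 + c * x $ 3" for x
    by (simp add: det3_expand a_def b_def c_def algebra_simps)
  have "a = 0" "a + b + c = 0" "a - b + c = 0"
    using z[of 0] z[of 1] z[of "-1"] by (simp_all add: * vector_3)
  then have "a = 0" "b = 0" "c = 0"
    by (simp_all add: algebra_simps add_eq_0_iff)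
  then show False using assms * by simp
qed

lemma det3_nonzero_exists:
  assumes "u \<noteq> 0"
  shows "\<exists>v w. det3 u v w \<noteq> 0"
proof -
  obtain k where k: "u $ k \<noteq> 0" using assms by (auto simp: vec_eq_iff)
  have "det3 u (axis 2 1) (axis 3 1) = u $ 1" "det3 u (axis 3 1) (axis 1 1) = u $ 2"
    "det3 u (axis 1 1) (axis 2 1) = u $ 3"
    by (simp_all add: det3_expand axis_def)
  then show ?thesis using k exhaust_3[of k] by metis
qed

text \<open>
  One-parameter candidates for \<open>\<gamma> x\<close>: forced dependencies with pairs of old points hold for all \<open>t\<close>,
  and every other dependency fails for some, hence for all but finitely many \<open>t\<close>.
\<close>

definition extension_curve ::
  "'a set set \<Rightarrow> 'a set \<Rightarrow> 'a \<Rightarrow> ('a \<Rightarrow> complex ^ 3) \<Rightarrow> (complex \<Rightarrow> complex ^ 3) \<Rightarrow> bool" where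
  "extension_curve L A x \<gamma> V \<longleftrightarrow> (\<forall>k. polyfun (\<lambda>t. V t $ k)) \<and> (\<exists>t. V t \<noteq> 0) \<and>
    (\<forall>i\<in>A. \<exists>w t. det3 (\<gamma> i) w (V t) \<noteq> 0) \<and>
    (\<forall>i\<in>A. \<forall>j\<in>A. i \<noteq> j \<longrightarrow>
      (if \<exists>l\<in>L. {i, j, x} \<subseteq> l then \<forall>t. det3 (\<gamma> i) (\<gamma> j) (V t) = 0
       else \<exists>t. det3 (\<gamma> i) (\<gamma> j) (V t) \<noteq> 0))"

text \<open>All forced dependencies of \<open>x\<close> come from \<open>l\<close>, since
  \<open>addable\<close> makes any other confining line equal to it; hence combinations of
  \<open>\<gamma> u\<close> and \<open>\<gamma> v\<close> are admissible. A dependency with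
  \<open>i\<close> and \<open>j\<close> at every parameter puts \<open>\<gamma> u\<close> and
  \<open>\<gamma> v\<close> into the span of \<open>\<gamma> i\<close> and
  \<open>\<gamma> j\<close>, so \<open>i\<close> and \<open>j\<close> lie on \<open>l\<close>
  together with \<open>x\<close>, and the dependency was forced.\<close>

lemma extension_curve_line:
  assumes sys: "linear_system E L" and A: "A \<subseteq> E" and R: "realizes L A \<gamma>"
    and add: "addable L A x" and l: "l \<in> L" "x \<in> l"
    and uv: "u \<in> l \<inter> A" "v \<in> l \<inter> A" "u \<noteq> v"
  shows "\<exists>V. extension_curve L A x \<gamma> V"
proof -
  define V where "V t = 1 *s \<gamma> u + t *s \<gamma> v" for t
  have V: "det3 a b (V t) = det3 a b (\<gamma> u) + t * det3 a b (\<gamma> v)" for a b t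
    by (simp only: V_def det3_linear) simp
  \<comment> \<open>The determinant is affine in \<open>t\<close>: if it is nonzero at
    \<open>\<gamma> u\<close> take \<open>t = 0\<close>, otherwise \<open>t = 1\<close>.\<close>
  have nonzero: "\<exists>t. det3 a b (V t) \<noteq> 0" if "det3 a b (\<gamma> u) \<noteq> 0 \<or> det3 a b (\<gamma> v) \<noteq> 0" for a b
    using that V[of a b 0] V[of a b 1] by (metis add_cancel_left_left mult_1 mult_zero_left add_0_right)
  have "polyfun (\<lambda>t. V t $ k)" for k
    by (simp add: V_def polyfun_add polyfun_mult polyfun_const polyfun_id)
  moreover have "V 0 \<noteq> 0"
    using R uv by (simp add: V_def realizes_def)
  moreover have "\<exists>w t. det3 (\<gamma> i) w (V t) \<noteq> 0" if i: "i \<in> A" for i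
  proof -
    define j where "j = (if i = u then v else u)"
    have "i \<noteq> j" "j \<in> A" using uv by (auto simp: j_def)
    then obtain w where "det3 (\<gamma> i) (\<gamma> j) w \<noteq> 0"
      using realizesD(2)[OF R i] by blast
    then have "det3 (\<gamma> i) w (\<gamma> j) \<noteq> 0" by (simp add: det3_swap(2)[of _ _ w])
    then show ?thesis using nonzero[of "\<gamma> i" w] by (auto simp: j_def split: if_splits)
  qed
  moreover have "det3 (\<gamma> i) (\<gamma> j) (V t) = 0"
    if ij: "i \<in> A" "j \<in> A" "i \<noteq> j" and m: "m \<in> L" "{i, j, x} \<subseteq> m" for i j m t
  proof -
    have "m = l" using add l uv ij m unfolding addable_def by (meson IntI insert_subset)
    then show ?thesis
      using realizes_det3_zero[OF R l(1), of i j] ij m uv by (simp add: V)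
  qed
  moreover have "\<exists>t. det3 (\<gamma> i) (\<gamma> j) (V t) \<noteq> 0"
    if ij: "i \<in> A" "j \<in> A" "i \<noteq> j" and no: "\<not> (\<exists>l\<in>L. {i, j, x} \<subseteq> l)" for i j
  proof (rule ccontr)
    assume "\<not> ?thesis"
    then have z: "det3 (\<gamma> i) (\<gamma> j) (\<gamma> u) = 0" "det3 (\<gamma> i) (\<gamma> j) (\<gamma> v) = 0"
      using nonzero by blast+
    obtain w where w: "det3 (\<gamma> i) (\<gamma> j) w \<noteq> 0"
      using realizesD(2)[OF R ij] by blast
    obtain s t where u: "\<gamma> u = s *s \<gamma> i + t *s \<gamma> j" using det3_span2[OF w z(1)] .
    obtain s' t' where v: "\<gamma> v = s' *s \<gamma> i + t' *s \<gamma> j" using det3_span2[OF w z(2)] .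
    have on_l: "k \<in> l" if k: "k \<in> A" "det3 (\<gamma> u) (\<gamma> v) (\<gamma> k) = 0" for k
    proof (cases "k = u \<or> k = v")
      case True
      then show ?thesis using uv by blast
    next
      case False
      then have "\<exists>m\<in>L. {u, v, k} \<subseteq> m"
        using realizesD(3)[OF R, of u v k] uv k by auto
      then obtain m where m: "m \<in> L" "{u, v, k} \<subseteq> m" by blast
      then have "m = l" using linear_system_unique[OF sys _ l(1), of m u v] uv by simp
      then show ?thesis using m by blast
    qed
    have "det3 (\<gamma> u) (\<gamma> v) (\<gamma> i) = 0" "det3 (\<gamma> u) (\<gamma> v) (\<gamma> j) = 0"
      unfolding u v by (simp_all add: det3_linear)
    then have "{i, j, x} \<subseteq> l" using on_l ij l by blast
    then show False using no l by blast
  qed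
  ultimately show ?thesis
    unfolding extension_curve_def by (intro exI[of _ V]) auto
qed

text \<open>No line through \<open>x\<close> has two points in \<open>A\<close>, so nothing is
  forced, and the moment curve escapes each of the planes to be avoided.\<close>

lemma extension_curve_free:
  assumes R: "realizes L A \<gamma>"
    and free: "\<And>l i j. l \<in> L \<Longrightarrow> x \<in> l \<Longrightarrow> i \<in> l \<inter> A \<Longrightarrow> j \<in> l \<inter> A \<Longrightarrow> i = j"
  shows "\<exists>V. extension_curve L A x \<gamma> V"
proof -
  define V :: "complex \<Rightarrow> complex ^ 3" where "V t = vector [1, t, t\<^sup>2]" for t
  have "polyfun (\<lambda>t. V t $ k)" for k
    using exhaust_3[of k] polyfun_mult[OF polyfun_id polyfun_id]
    by (auto simp: V_def vector_3 power2_eq_square)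
  moreover have "V 0 \<noteq> 0"
    by (simp add: V_def vec_eq_iff forall_3 vector_3)
  moreover have "\<exists>w t. det3 (\<gamma> i) w (V t) \<noteq> 0" if "i \<in> A" for i
    using det3_nonzero_exists[OF realizesD(1)[OF R that]] moment_curve_det3 unfolding V_def by metis
  moreover have "\<exists>t. det3 (\<gamma> i) (\<gamma> j) (V t) \<noteq> 0" if "i \<in> A" "j \<in> A" "i \<noteq> j" for i j
    using realizesD(2)[OF R that] moment_curve_det3 unfolding V_def by metis
  moreover have "\<not> (\<exists>l\<in>L. {i, j, x} \<subseteq> l)" if "i \<in> A" "j \<in> A" "i \<noteq> j" for i j
    using free that by blast
  ultimately show ?thesis
    unfolding extension_curve_def by (intro exI[of _ V]) auto
qed

text \<open>Each requirement not built into the curve excludes finitely many parameters: one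
  coordinate \<open>k\<close> controls nonvanishing, fixed witnesses \<open>w i\<close> control
  pairs, and the unforced pairs in \<open>P\<close> control triples.\<close>

lemma realizes_extend:
  assumes fin: "finite A" and x: "x \<notin> A" and R: "realizes L A \<gamma>"
    and curve: "extension_curve L A x \<gamma> V"
  shows "\<exists>\<delta>. realizes L (insert x A) \<delta>"
proof -
  have V: "\<And>k. polyfun (\<lambda>t. V t $ k)" "\<exists>t. V t \<noteq> 0" "\<forall>i\<in>A. \<exists>w t. det3 (\<gamma> i) w (V t) \<noteq> 0"
    "\<forall>i\<in>A. \<forall>j\<in>A. i \<noteq> j \<longrightarrow>
      (if \<exists>l\<in>L. {i, j, x} \<subseteq> l then \<forall>t. det3 (\<gamma> i) (\<gamma> j) (V t) = 0
       else \<exists>t. det3 (\<gamma> i) (\<gamma> j) (V t) \<noteq> 0)"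
    using curve by (simp_all add: extension_curve_def)
  obtain k t\<^sub>0 where k: "V t\<^sub>0 $ k \<noteq> 0" using V(2) by (metis vec_eq_iff zero_index)
  obtain w where w: "\<And>i. i \<in> A \<Longrightarrow> \<exists>t. det3 (\<gamma> i) (w i) (V t) \<noteq> 0" using V(3) by metis
  define P where "P = {(i, j). i \<in> A \<and> j \<in> A \<and> i \<noteq> j \<and> \<not> (\<exists>l\<in>L. {i, j, x} \<subseteq> l)}"
  have "P \<subseteq> A \<times> A" by (auto simp: P_def)
  then have "finite P" using fin finite_subset by blast
  have poly: "polyfun (\<lambda>t. det3 a b (V t))" for a b
    using V(1) by (intro polyfun_det3) auto
  have "finite {t. det3 (\<gamma> i) (w i) (V t) = 0}" if "i \<in> A" for i
    using w[OF that] polyfun_finite_zeros[OF poly] by blast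
  moreover have "finite {t. det3 (\<gamma> i) (\<gamma> j) (V t) = 0}" if "(i, j) \<in> P" for i j
  proof -
    have "\<exists>t. det3 (\<gamma> i) (\<gamma> j) (V t) \<noteq> 0"
      using that V(4) by (simp add: P_def)
    then show ?thesis using polyfun_finite_zeros[OF poly] by blast
  qed
  ultimately have bad: "finite ({t. V t $ k = 0} \<union> (\<Union>i\<in>A. {t. det3 (\<gamma> i) (w i) (V t) = 0}) \<union>
      (\<Union>p\<in>P. {t. det3 (\<gamma> (fst p)) (\<gamma> (snd p)) (V t) = 0}))"
    using fin \<open>finite P\<close> polyfun_finite_zeros[of "\<lambda>t. V t $ k", OF V(1) k] by simp
  obtain t where t\<^sub>1: "t \<notin> {t. V t $ k = 0} \<union> (\<Union>i\<in>A. {t. det3 (\<gamma> i) (w i) (V t) = 0}) \<union>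
      (\<Union>p\<in>P. {t. det3 (\<gamma> (fst p)) (\<gamma> (snd p)) (V t) = 0})"
    using ex_new_if_finite[OF infinite_UNIV_char_0 bad] by (elim exE) (rule that)
  then have t: "V t $ k \<noteq> 0" "\<And>i. i \<in> A \<Longrightarrow> det3 (\<gamma> i) (w i) (V t) \<noteq> 0"
    "\<And>p. p \<in> P \<Longrightarrow> det3 (\<gamma> (fst p)) (\<gamma> (snd p)) (V t) \<noteq> 0"
    by simp_all
  define \<delta> where "\<delta> = \<gamma>(x := V t)"
  have \<delta>: "\<delta> x = V t" "\<And>i. i \<in> A \<Longrightarrow> \<delta> i = \<gamma> i" using x by (auto simp: \<delta>_def)
  have "V t \<noteq> 0" using t(1) by auto
  then have nz: "\<delta> i \<noteq> 0" if "i \<in> insert x A" for i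
    using that realizesD(1)[OF R] \<delta> by auto
  have pair: "\<exists>w. det3 (\<gamma> i) (V t) w \<noteq> 0" "\<exists>w. det3 (V t) (\<gamma> i) w \<noteq> 0" if "i \<in> A" for i
    using t(2)[OF that] det3_swap(2)[of "\<gamma> i" "V t" "w i"] det3_swap(1)[of "\<gamma> i" "V t" "w i"]
    by (intro exI[of _ "w i"]; simp)+
  have pairs: "\<exists>w. det3 (\<delta> i) (\<delta> j) w \<noteq> 0" if "i \<in> insert x A" "j \<in> insert x A" "i \<noteq> j" for i j
    using that realizesD(2)[OF R] \<delta> pair by auto
  have new: "det3 (\<gamma> i) (\<gamma> j) (V t) = 0 \<longleftrightarrow> (\<exists>l\<in>L. {i, j, x} \<subseteq> l)"
    if "i \<in> A" "j \<in> A" "i \<noteq> j" for i j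
    using V(4) t(3)[of "(i, j)"] that unfolding P_def by (auto split: if_splits)
  have "det3 (\<delta> i) (\<delta> j) (\<delta> k) = 0 \<longleftrightarrow> (\<exists>l\<in>L. {i, j, k} \<subseteq> l)"
    if mem: "i \<in> insert x A" "j \<in> insert x A" "k \<in> insert x A" and neq: "i \<noteq> j" "i \<noteq> k" "j \<noteq> k" for i j k
  proof -
    consider "i \<in> A" "j \<in> A" "k \<in> A" | "i = x" "j \<in> A" "k \<in> A" | "i \<in> A" "j = x" "k \<in> A"
      | "i \<in> A" "j \<in> A" "k = x"
      using mem neq by blast
    then show ?thesis
    proof cases
      case 1
      then show ?thesis using realizesD(3)[OF R] neq \<delta> by simp
    next
      case 2
      then show ?thesis using new[of j k] neq \<delta> det3_rotate(1)[of "\<gamma> j" "\<gamma> k" "V t"]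
        by (simp add: det3_rotate(2) insert_commute conj_ac)
    next
      case 3
      then show ?thesis using new[of i k] neq \<delta> det3_swap(2)[of "\<gamma> i" "\<gamma> k" "V t"]
        by (simp add: conj_ac)
    next
      case 4
      then show ?thesis using new[of i j] neq \<delta> by simp
    qed
  qed
  then have "realizes L (insert x A) \<delta>"
    using nz pairs unfolding realizes_def by meson
  then show ?thesis by blast
qed

lemma realizes_built:
  assumes sys: "linear_system E L" and "built L {} A" and "A \<subseteq> E"
  shows "\<exists>\<gamma>. realizes L A \<gamma>"
  using assms(2,3)
proof (induction rule: built.induct)
  case refl
  show ?case by (simp add: realizes_def)
next
  case (step A x)
  then obtain \<gamma> where R: "realizes L A \<gamma>" by auto
  have fin: "finite A"
    using step.prems finite_subset[OF _ linear_systemD(1)[OF sys]] by simp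
  show ?case
  proof (cases "\<exists>l\<in>L. x \<in> l \<and> (\<exists>u\<in>l \<inter> A. \<exists>v\<in>l \<inter> A. u \<noteq> v)")
    case True
    then obtain l u v where *: "l \<in> L" "x \<in> l" "u \<in> l \<inter> A" "v \<in> l \<inter> A" "u \<noteq> v" by blast
    have A: "A \<subseteq> E" using step.prems by blast
    show ?thesis
      using extension_curve_line[OF sys A R step.hyps(3) *]
        realizes_extend[OF fin step.hyps(2) R] by blast
  next
    case False
    then have free: "i = j" if "l \<in> L" "x \<in> l" "i \<in> l \<inter> A" "j \<in> l \<inter> A" for l i j
      using that by blast
    have "\<exists>V. extension_curve L A x \<gamma> V"
      using R by (rule extension_curve_free) (rule free)
    then show ?thesis
      using realizes_extend[OF fin step.hyps(2) R] by blast
  qed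
qed

section \<open>Curves of realizations\<close>

text \<open>Only the forced dependencies are demanded along the curve. Independence may fail at
  individual parameters; \<open>finite_not_realizes\<close> recovers it for almost all of them from
  the endpoint 0.\<close>

definition joining_curve ::
  "'a set set \<Rightarrow> 'a set \<Rightarrow> ('a \<Rightarrow> complex ^ 3) \<Rightarrow> ('a \<Rightarrow> complex ^ 3) \<Rightarrow>
    (complex \<Rightarrow> 'a \<Rightarrow> complex ^ 3) \<Rightarrow> bool" where
  "joining_curve L A \<alpha> \<beta> c \<longleftrightarrow>
    (\<forall>i k. polyfun (\<lambda>z. c z i $ k)) \<and> (\<forall>i\<in>A. c 0 i = \<alpha> i \<and> c 1 i = \<beta> i) \<and>
    (\<forall>z. \<forall>l\<in>L. \<forall>i\<in>l \<inter> A. \<forall>j\<in>l \<inter> A. \<forall>k\<in>l \<inter> A. det3 (c z i) (c z j) (c z k) = 0)"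

text \<open>
  A new point on the line of \<open>u\<close> and \<open>v\<close> is a combination of them in both realizations;
  interpolating the coefficients keeps it in their span along the whole curve.
\<close>

lemma joining_curve_built:
  assumes "built L {} A" and "realizes L A \<alpha>" and "realizes L A \<beta>"
  shows "\<exists>c. joining_curve L A \<alpha> \<beta> c"
  using assms
proof (induction rule: built.induct)
  case refl
  show ?case by (rule exI[of _ "\<lambda>z i. 0"]) (simp add: joining_curve_def polyfun_const)
next
  case (step A x)
  have sub: "realizes L A \<gamma>" if "realizes L (insert x A) \<gamma>" for \<gamma>
    using that by (rule realizes_subset) blast
  obtain c where "joining_curve L A \<alpha> \<beta> c"
    using step.IH[OF sub[OF step.prems(1)] sub[OF step.prems(2)]] ..
  then have c: "\<And>i k. polyfun (\<lambda>z. c z i $ k)"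
    "\<And>i. i \<in> A \<Longrightarrow> c 0 i = \<alpha> i" "\<And>i. i \<in> A \<Longrightarrow> c 1 i = \<beta> i"
    "\<And>z l i j k. l \<in> L \<Longrightarrow> i \<in> l \<inter> A \<Longrightarrow> j \<in> l \<inter> A \<Longrightarrow> k \<in> l \<inter> A \<Longrightarrow> det3 (c z i) (c z j) (c z k) = 0"
    by (simp_all add: joining_curve_def)
  have extend: ?case
    if V: "\<And>k. polyfun (\<lambda>z. V z $ k)" "V 0 = \<alpha> x" "V 1 = \<beta> x"
      "\<And>z l i j. l \<in> L \<Longrightarrow> x \<in> l \<Longrightarrow> i \<in> l \<inter> A \<Longrightarrow> j \<in> l \<inter> A \<Longrightarrow> i \<noteq> j \<Longrightarrow> det3 (c z i) (c z j) (V z) = 0"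
    for V
  proof (rule exI)
    let ?c = "\<lambda>z. (c z)(x := V z)"
    show "joining_curve L (insert x A) \<alpha> \<beta> ?c"
      unfolding joining_curve_def
    proof (intro conjI allI ballI)
      show "polyfun (\<lambda>z. ?c z i $ k)" for i k
        using c(1) V(1) by (cases "i = x") simp_all
      show "?c 0 i = \<alpha> i" "?c 1 i = \<beta> i" if "i \<in> insert x A" for i
        using that c(2,3) V(2,3) by auto
      fix z l i j k
      assume l: "l \<in> L" and ijk: "i \<in> l \<inter> insert x A" "j \<in> l \<inter> insert x A" "k \<in> l \<inter> insert x A"
      have V4: "det3 (c z i) (c z j) (V z) = 0" if "x \<in> l" "i \<in> l \<inter> A" "j \<in> l \<inter> A" for i j
        using V(4)[OF l that] by (cases "i = j") auto
      have c4: "det3 (c z i) (c z j) (c z k) = 0" if "i \<in> l \<inter> A" "j \<in> l \<inter> A" "k \<in> l \<inter> A" for i j k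
        using c(4)[OF l that] .
      have A: "a \<in> l \<inter> A" if "a \<in> l \<inter> insert x A" "a \<noteq> x" for a using that by blast
      consider "i = j" | "i = k" | "j = k" | "i \<noteq> x" "j \<noteq> x" "k \<noteq> x"
        | "i = x" "j \<noteq> x" "k \<noteq> x" | "i \<noteq> x" "j = x" "k \<noteq> x" | "i \<noteq> x" "j \<noteq> x" "k = x"
        by blast
      then show "det3 (?c z i) (?c z j) (?c z k) = 0"
      proof cases
        case 4 then show ?thesis using c4 A ijk by simp
      next
        case 5
        then have "x \<in> l" using ijk by blast
        then show ?thesis using 5 V4[of j k] A ijk det3_rotate(1)[of "c z j" "c z k" "V z"] by simp
      next
        case 6
        then have "x \<in> l" using ijk by blast
        then show ?thesis using 6 V4[of i k] A ijk det3_swap(2)[of "c z i" "V z" "c z k"] by simp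
      next
        case 7
        then have "x \<in> l" using ijk by blast
        then show ?thesis using 7 V4[of i j] A ijk by simp
      qed auto
    qed
  qed
  show ?case
  proof (cases "\<exists>l\<in>L. x \<in> l \<and> (\<exists>u\<in>l \<inter> A. \<exists>v\<in>l \<inter> A. u \<noteq> v)")
    case True
    then obtain l u v where l: "l \<in> L" "x \<in> l" and uv: "u \<in> l \<inter> A" "v \<in> l \<inter> A" "u \<noteq> v" by blast
    have span: "\<exists>s t. \<gamma> x = s *s \<gamma> u + t *s \<gamma> v" if R: "realizes L (insert x A) \<gamma>" for \<gamma>
    proof -
      obtain w where w: "det3 (\<gamma> u) (\<gamma> v) w \<noteq> 0" using realizesD(2)[OF R, of u v] uv by blast
      have "det3 (\<gamma> u) (\<gamma> v) (\<gamma> x) = 0"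
        using realizes_det3_zero[OF R l(1)] uv l(2) by blast
      then show ?thesis using det3_span2[OF w] by metis
    qed
    obtain s t where a: "\<alpha> x = s *s \<alpha> u + t *s \<alpha> v" using span step.prems(1) by blast
    obtain s' t' where b: "\<beta> x = s' *s \<beta> u + t' *s \<beta> v" using span step.prems(2) by blast
    \<comment> \<open>The coefficient pairs at the two ends are interpolated linearly and applied to
      the moving vectors \<open>c z u\<close> and \<open>c z v\<close>; the determinants on
      \<open>l\<close> vanish by linearity even where these two become dependent.\<close>
    define V where "V z = ((1 - z) * s + z * s') *s c z u + ((1 - z) * t + z * t') *s c z v" for z
    show ?thesis
    proof (rule extend)
      show "polyfun (\<lambda>z. V z $ k)" for k
        unfolding V_def using c(1)[of u k] c(1)[of v k]
        by (auto intro!: polyfun_add polyfun_mult polyfun_diff)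
      show "V 0 = \<alpha> x" "V 1 = \<beta> x"
        using c(2,3) uv by (simp_all add: V_def a b)
      fix z m i j
      assume m: "m \<in> L" "x \<in> m" and ij: "i \<in> m \<inter> A" "j \<in> m \<inter> A" "i \<noteq> j"
      have "m = l" using step.hyps(3) l uv m ij unfolding addable_def by meson
      then show "det3 (c z i) (c z j) (V z) = 0"
        unfolding V_def det3_linear using c(4)[OF l(1), of i j] ij uv by simp
    qed
  next
    case False
    define V where "V z = (1 - z) *s \<alpha> x + z *s \<beta> x" for z
    show ?thesis
    proof (rule extend)
      show "polyfun (\<lambda>z. V z $ k)" for k
        unfolding V_def by (auto intro!: polyfun_add polyfun_mult polyfun_diff)
      show "V 0 = \<alpha> x" "V 1 = \<beta> x" by (simp_all add: V_def)
    qed (use False in blast)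
  qed
qed

section \<open>From joining curves to irreducibility\<close>

lemma realizes_cong:
  assumes "\<And>i. i \<in> A \<Longrightarrow> \<gamma> i = \<delta> i"
  shows "realizes L A \<gamma> \<longleftrightarrow> realizes L A \<delta>"
  using assms by (simp add: realizes_def)

lemma polynomial_funs_cong:
  assumes "f \<in> polynomial_funs E" "\<And>i. i \<in> E \<Longrightarrow> \<gamma> i = \<delta> i"
  shows "f \<gamma> = f \<delta>"
  using assms by (induction rule: polynomial_funs.induct) auto

lemma polyfun_polynomial_funs:
  assumes "f \<in> polynomial_funs E" "\<And>i k. polyfun (\<lambda>z. c z i $ k)"
  shows "polyfun (\<lambda>z. f (c z))"
  using assms by (induction rule: polynomial_funs.induct)
    (simp_all add: polyfun_const polyfun_add polyfun_mult)

text \<open>Coordinates \<open>k i\<close> and witnesses \<open>w i j\<close> are chosen for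
  \<open>\<alpha>\<close> and kept fixed along the curve, so each inequation is a single polynomial
  in \<open>z\<close>, nonzero at \<open>z = 0\<close>. There are finitely many of them, and the
  equations hold by \<open>joining_curve\<close>.\<close>

lemma finite_not_realizes:
  assumes sys: "linear_system E L" and R: "realizes L E \<alpha>" and c: "joining_curve L E \<alpha> \<beta> c"
  shows "finite {z. \<not> realizes L E (c z)}"
proof -
  have fin: "finite E" using linear_systemD(1)[OF sys] .
  have poly: "polyfun (\<lambda>z. c z i $ k)" for i k using c by (simp add: joining_curve_def)
  have c0: "c 0 i = \<alpha> i" if "i \<in> E" for i using c that by (simp add: joining_curve_def)
  have "\<exists>k. \<alpha> i $ k \<noteq> 0" if "i \<in> E" for i
    using realizesD(1)[OF R that] by (auto simp: vec_eq_iff)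
  then obtain k where k: "\<And>i. i \<in> E \<Longrightarrow> \<alpha> i $ k i \<noteq> 0" by metis
  have "\<exists>w. det3 (\<alpha> i) (\<alpha> j) w \<noteq> 0" if "i \<in> E" "j \<in> E" "i \<noteq> j" for i j
    using realizesD(2)[OF R that] .
  then obtain w where w: "\<And>i j. i \<in> E \<Longrightarrow> j \<in> E \<Longrightarrow> i \<noteq> j \<Longrightarrow> det3 (\<alpha> i) (\<alpha> j) (w i j) \<noteq> 0"
    by metis
  define B1 where "B1 = (\<Union>i\<in>E. {z. c z i $ k i = 0})"
  define B2 where "B2 = (\<Union>i\<in>E. \<Union>j\<in>E - {i}. {z. det3 (c z i) (c z j) (w i j) = 0})"
  \<comment> \<open>Only triples independent at \<open>\<alpha>\<close> enter: outside
    \<open>B3\<close> a vanishing determinant vanishes at \<open>\<alpha>\<close> as well, so the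
    triple lies on a line.\<close>
  define B3 where "B3 = (\<Union>i\<in>E. \<Union>j\<in>E. \<Union>k\<in>{k \<in> E. det3 (\<alpha> i) (\<alpha> j) (\<alpha> k) \<noteq> 0}.
    {z. det3 (c z i) (c z j) (c z k) = 0})"
  have "finite {z. c z i $ k i = 0}" if "i \<in> E" for i
    using polyfun_finite_zeros[OF poly, of 0 i "k i"] c0[OF that] k[OF that] by simp
  then have "finite B1" using fin by (simp add: B1_def)
  have "finite {z. det3 (c z i) (c z j) (w i j) = 0}" if "i \<in> E" "j \<in> E" "i \<noteq> j" for i j
    using polyfun_finite_zeros[OF polyfun_det3[OF poly poly polyfun_const], of 0 i j "w i j"]
      c0 w[OF that] that by simp
  then have "finite B2" using fin by (auto simp: B2_def)
  have "finite {z. det3 (c z i) (c z j) (c z k) = 0}"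
    if "i \<in> E" "j \<in> E" "k \<in> E" "det3 (\<alpha> i) (\<alpha> j) (\<alpha> k) \<noteq> 0" for i j k
    using polyfun_finite_zeros[OF polyfun_det3[OF poly poly poly], of 0 i j k] c0 that by simp
  then have "finite B3" using fin by (simp add: B3_def)
  have "realizes L E (c z)" if z: "z \<notin> B1" "z \<notin> B2" "z \<notin> B3" for z
    unfolding realizes_def
  proof (intro conjI ballI impI)
    show "c z i \<noteq> 0" if "i \<in> E" for i
      using z(1) that by (auto simp: B1_def)
    show "\<exists>w. det3 (c z i) (c z j) w \<noteq> 0" if "i \<in> E" "j \<in> E" "i \<noteq> j" for i j
      using z(2) that by (intro exI[of _ "w i j"]) (simp add: B2_def)
    fix i j k assume ijk: "i \<in> E" "j \<in> E" "k \<in> E" "i \<noteq> j \<and> i \<noteq> k \<and> j \<noteq> k"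
    show "det3 (c z i) (c z j) (c z k) = 0 \<longleftrightarrow> (\<exists>l\<in>L. {i, j, k} \<subseteq> l)"
    proof
      assume "det3 (c z i) (c z j) (c z k) = 0"
      then have "det3 (\<alpha> i) (\<alpha> j) (\<alpha> k) = 0" using z(3) ijk unfolding B3_def by blast
      then show "\<exists>l\<in>L. {i, j, k} \<subseteq> l" using realizesD(3)[OF R] ijk by blast
    next
      assume "\<exists>l\<in>L. {i, j, k} \<subseteq> l"
      then show "det3 (c z i) (c z j) (c z k) = 0"
        using c ijk by (auto simp: joining_curve_def)
    qed
  qed
  then have "{z. \<not> realizes L E (c z)} \<subseteq> B1 \<union> B2 \<union> B3" by blast
  then show ?thesis
    using \<open>finite B1\<close> \<open>finite B2\<close> \<open>finite B3\<close> by (meson finite_UnI finite_subset)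
qed

lemma realizes_common_nonzero:
  assumes sys: "linear_system E L" and built: "built L {} E"
    and R: "realizes L E \<alpha>" "realizes L E \<beta>"
    and f: "f \<in> polynomial_funs E" "f \<alpha> \<noteq> 0" and g: "g \<in> polynomial_funs E" "g \<beta> \<noteq> 0"
  shows "\<exists>\<gamma>\<in>E \<rightarrow>\<^sub>E UNIV. realizes L E \<gamma> \<and> f \<gamma> \<noteq> 0 \<and> g \<gamma> \<noteq> 0"
proof -
  obtain c where c: "joining_curve L E \<alpha> \<beta> c" using joining_curve_built[OF built R] ..
  have poly: "polyfun (\<lambda>z. c z i $ k)" for i k using c by (simp add: joining_curve_def)
  have "f (c 0) = f \<alpha>" "g (c 1) = g \<beta>"
    using c polynomial_funs_cong[OF f(1), of "c 0" \<alpha>] polynomial_funs_cong[OF g(1), of "c 1" \<beta>]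
    by (simp_all add: joining_curve_def)
  then have "finite {z. f (c z) = 0}" "finite {z. g (c z) = 0}"
    using polyfun_finite_zeros[OF polyfun_polynomial_funs[OF f(1) poly], of 0]
      polyfun_finite_zeros[OF polyfun_polynomial_funs[OF g(1) poly], of 1] f(2) g(2) by simp_all
  then have bad: "finite ({z. \<not> realizes L E (c z)} \<union> {z. f (c z) = 0} \<union> {z. g (c z) = 0})"
    using finite_not_realizes[OF sys R(1) c] by simp
  obtain z where z: "z \<notin> {z. \<not> realizes L E (c z)} \<union> {z. f (c z) = 0} \<union> {z. g (c z) = 0}"
    using ex_new_if_finite[OF infinite_UNIV_char_0 bad] by (elim exE) (rule that)
  \<comment> \<open>Values outside \<open>E\<close> are reset to land in the extensional function
    space; polynomial functions and \<open>realizes\<close> depend only on the values in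
    \<open>E\<close>.\<close>
  let ?\<gamma> = "restrict (c z) E"
  have "realizes L E ?\<gamma>" using z realizes_cong[of E ?\<gamma> "c z" L] by simp
  moreover have "f ?\<gamma> = f (c z)" "g ?\<gamma> = g (c z)"
    using polynomial_funs_cong[OF f(1), of ?\<gamma> "c z"] polynomial_funs_cong[OF g(1), of ?\<gamma> "c z"] by simp_all
  ultimately show ?thesis
    using z by (intro bexI[of _ ?\<gamma>]) auto
qed

text \<open>A closed set that fails to contain the closure already fails to contain
  \<open>S\<close>. The two omitted points of \<open>S\<close> give \<open>f\<close> and
  \<open>g\<close>, and a point of \<open>S\<close> where both are nonzero lies outside both closed
  sets.\<close>

lemma irreducible_in_closure_zariski:
  assumes S: "S \<subseteq> E \<rightarrow>\<^sub>E UNIV" "S \<noteq> {}"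
    and common: "\<And>f g \<alpha> \<beta>. f \<in> polynomial_funs E \<Longrightarrow> g \<in> polynomial_funs E \<Longrightarrow>
      \<alpha> \<in> S \<Longrightarrow> \<beta> \<in> S \<Longrightarrow> f \<alpha> \<noteq> 0 \<Longrightarrow> g \<beta> \<noteq> 0 \<Longrightarrow> \<exists>\<gamma>\<in>S. f \<gamma> \<noteq> 0 \<and> g \<gamma> \<noteq> 0"
  shows "irreducible_in (zariski_topology E) (zariski_topology E closure_of S)"
  unfolding irreducible_in_def
proof (intro conjI allI impI)
  let ?X = "zariski_topology E"
  have sub: "S \<subseteq> ?X closure_of S"
    using S(1) by (intro closure_of_subset) (simp add: topspace_zariski)
  then show "?X closure_of S \<noteq> {}" using S(2) by blast
  show "?X closure_of S \<subseteq> topspace ?X" by (rule closure_of_subset_topspace)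
  fix A B assume "closedin ?X A \<and> closedin ?X B \<and> ?X closure_of S \<subseteq> A \<union> B"
  then have A: "closedin ?X A" and B: "closedin ?X B" and cover: "?X closure_of S \<subseteq> A \<union> B"
    by simp_all
  obtain F where F: "F \<subseteq> polynomial_funs E" "A = zero_locus E F" using A closedin_zariski by metis
  obtain G where G: "G \<subseteq> polynomial_funs E" "B = zero_locus E G" using B closedin_zariski by metis
  show "?X closure_of S \<subseteq> A \<or> ?X closure_of S \<subseteq> B"
  proof (rule ccontr)
    assume "\<not> ?thesis"
    then have "\<not> S \<subseteq> A" "\<not> S \<subseteq> B"
      using closure_of_minimal[OF _ A, of S] closure_of_minimal[OF _ B, of S] by blast+
    then obtain \<alpha> \<beta> f g where "\<alpha> \<in> S" "f \<in> F" "f \<alpha> \<noteq> 0" "\<beta> \<in> S" "g \<in> G" "g \<beta> \<noteq> 0"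
      using S(1) unfolding F(2) G(2) zero_locus_def by blast
    then obtain \<gamma> where "\<gamma> \<in> S" "f \<gamma> \<noteq> 0" "g \<gamma> \<noteq> 0" "f \<in> F" "g \<in> G"
      using common[of f g \<alpha> \<beta>] F(1) G(1) by blast
    then show False using cover sub unfolding F(2) G(2) zero_locus_def by blast
  qed
qed

section \<open>Matroid varieties\<close>

text \<open>Size settles everything except triples: the rank bounds independent sets, and simplicity
  covers sets of size at most two. A dependent triple is itself collinear and by finiteness extends
  to a maximal collinear set.\<close>

lemma dep_simple_rank3_iff:
  assumes "simple_matroid M" "matroid_rank M = 3" "S \<subseteq> ground M"
  shows "dep M S \<longleftrightarrow> 3 < card S \<or> (card S = 3 \<and> (\<exists>l\<in>matroid_lines M. S \<subseteq> l))"
proof -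
  have fin: "finite (ground M)" and sub: "indeps M \<subseteq> Pow (ground M)"
    using assms(1) by (simp_all add: simple_matroid_def matroid_def)
  then have fin': "finite (indeps M)" using finite_subset by blast
  have le3: "card T \<le> 3" if "T \<in> indeps M" for T
    using Max_ge[OF finite_imageI[OF fin'] imageI[OF that, of card]] assms(2)
    by (simp add: matroid_rank_def)
  consider "card S \<le> 2" | "card S = 3" | "3 < card S" by linarith
  then show ?thesis
  proof cases
    case 1
    then show ?thesis using assms(1,3) unfolding simple_matroid_def by auto
  next
    case 3
    then show ?thesis using le3[of S] assms(3) by (auto simp: dep_def)
  next
    case 2
    have "\<exists>l\<in>matroid_lines M. S \<subseteq> l" if "dep M S"
    proof -
      have "T = S" if "T \<subseteq> S" "card T = 3" for T
        using that 2 by (metis card_subset_eq card.infinite zero_neq_numeral)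
      then have "collinear_set M S"
        using 2 that assms(3) unfolding collinear_set_def by auto
      moreover have "finite {l. collinear_set M l}"
        using fin by (rule finite_subset[rotated, OF finite_Pow_iff[THEN iffD2]]) (auto simp: collinear_set_def)
      ultimately obtain l where "collinear_set M l" "S \<subseteq> l"
        "\<And>m. collinear_set M m \<Longrightarrow> l \<subseteq> m \<Longrightarrow> l = m"
        using finite_has_maximal2[of "{l. collinear_set M l}" S] by auto
      then show ?thesis unfolding matroid_lines_def by blast
    qed
    moreover have "dep M S" if "l \<in> matroid_lines M" "S \<subseteq> l" for l
      using that 2 by (simp add: matroid_lines_def collinear_set_def)
    ultimately show ?thesis using 2 by auto
  qed
qed

lemma realizations_eq_realizes:
  assumes M: "simple_matroid M" "matroid_rank M = 3"
  shows "realizations M = {\<gamma> \<in> ground M \<rightarrow>\<^sub>E UNIV. realizes (matroid_lines M) (ground M) \<gamma>}"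
proof -
  let ?E = "ground M" and ?L = "matroid_lines M"
  note dep = dep_simple_rank3_iff[OF M]
  have fin: "finite ?E" using M(1) by (simp add: simple_matroid_def matroid_def)
  have "(\<forall>S. S \<subseteq> ?E \<longrightarrow> (dep M S \<longleftrightarrow> dependent_family \<gamma> S)) \<longleftrightarrow> realizes ?L ?E \<gamma>" for \<gamma>
  proof
    assume R: "\<forall>S. S \<subseteq> ?E \<longrightarrow> (dep M S \<longleftrightarrow> dependent_family \<gamma> S)"
    have "\<gamma> i \<noteq> 0" if "i \<in> ?E" for i
      using R[rule_format, of "{i}"] dep[of "{i}"] that by (simp add: dependent_family_singleton)
    moreover have "\<exists>w. det3 (\<gamma> i) (\<gamma> j) w \<noteq> 0" if "i \<in> ?E" "j \<in> ?E" "i \<noteq> j" for i j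
      using R[rule_format, of "{i, j}"] dep[of "{i, j}"] that by (simp add: dependent_family_doubleton)
    moreover have "det3 (\<gamma> i) (\<gamma> j) (\<gamma> k) = 0 \<longleftrightarrow> (\<exists>l\<in>?L. {i, j, k} \<subseteq> l)"
      if "i \<in> ?E" "j \<in> ?E" "k \<in> ?E" "i \<noteq> j" "i \<noteq> k" "j \<noteq> k" for i j k
      using R[rule_format, of "{i, j, k}"] dep[of "{i, j, k}"] that by (simp add: dependent_family_triple)
    ultimately show "realizes ?L ?E \<gamma>"
      unfolding realizes_def by meson
  next
    assume R: "realizes ?L ?E \<gamma>"
    show "\<forall>S. S \<subseteq> ?E \<longrightarrow> (dep M S \<longleftrightarrow> dependent_family \<gamma> S)"
    proof (intro allI impI)
      fix S assume S: "S \<subseteq> ?E"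
      then have finS: "finite S" using fin finite_subset by blast
      consider "S = {}" | i where "S = {i}" | i j where "i \<noteq> j" "S = {i, j}" | "card S = 3" | "3 < card S"
      proof -
        have "card S = 0 \<or> card S = 1 \<or> card S = 2 \<or> card S = 3 \<or> 3 < card S" by linarith
        then show thesis
          using finS that by (metis card_0_eq card_1_singletonE card_2_iff)
      qed
      then show "dep M S \<longleftrightarrow> dependent_family \<gamma> S"
      proof cases
        case 1
        then show ?thesis using dep[OF S] by (simp add: dependent_family_iff)
      next
        case (2 i)
        then show ?thesis using dep[OF S] realizesD(1)[OF R, of i] S by (simp add: dependent_family_singleton)
      next
        case (3 i j)
        then show ?thesis using dep[OF S] realizesD(2)[OF R, of i j] S by (simp add: dependent_family_doubleton)
      next
        case 4
        then obtain i j k where "S = {i, j, k}" "i \<noteq> j" "i \<noteq> k" "j \<noteq> k" by (auto simp: card_3_iff)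
        then show ?thesis
          using dep[OF S] realizesD(3)[OF R, of i j k] S 4 by (simp add: dependent_family_triple)
      next
        case 5
        then show ?thesis using dep[OF S] dependent_family_large by simp
      qed
    qed
  qed
  then show ?thesis unfolding realizations_def by simp
qed

theorem theorem3p9:
  fixes d :: nat and M :: "nat set_system"
  assumes "ground M = {1..d}" and "cactus_configuration M"
  shows "realizations M \<noteq> {} \<and>
    irreducible_in (zariski_topology {1..d}) (matroid_variety M)"
proof -
  let ?E = "ground M" and ?L = "matroid_lines M"
  have M: "simple_matroid M" "matroid_rank M = 3"
    using assms(2) by (simp_all add: cactus_configuration_def)
  have sys: "linear_system ?E ?L" using linear_system_simple_matroid[OF M(1)] .
  have built: "built ?L {} ?E" using cactus_configuration_built[OF assms(2)] .
  have eq: "realizations M = {\<gamma> \<in> ?E \<rightarrow>\<^sub>E UNIV. realizes ?L ?E \<gamma>}"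
    using realizations_eq_realizes[OF M] .
  obtain \<gamma> where "realizes ?L ?E \<gamma>" using realizes_built[OF sys built order_refl] ..
  then have "restrict \<gamma> ?E \<in> realizations M"
    using realizes_cong[of ?E \<gamma> "restrict \<gamma> ?E" ?L] by (simp add: eq)
  then have ne: "realizations M \<noteq> {}" by blast
  have "irreducible_in (zariski_topology ?E) (matroid_variety M)"
    unfolding matroid_variety_def
  proof (rule irreducible_in_closure_zariski[OF _ ne])
    show "realizations M \<subseteq> ?E \<rightarrow>\<^sub>E UNIV" by (auto simp: eq)
    fix f g \<alpha> \<beta>
    assume "f \<in> polynomial_funs ?E" "g \<in> polynomial_funs ?E" "\<alpha> \<in> realizations M"
      "\<beta> \<in> realizations M" "f \<alpha> \<noteq> 0" "g \<beta> \<noteq> 0"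
    then show "\<exists>\<gamma>\<in>realizations M. f \<gamma> \<noteq> 0 \<and> g \<gamma> \<noteq> 0"
      using realizes_common_nonzero[OF sys built, of \<alpha> \<beta> f g] unfolding eq by blast
  qed
  then show ?thesis using ne assms(1) by simp
qed

end
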